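(* Let $e \in \mathfrak{sp}(V)$ be nilpotent, with orthogonal decomposition $$V \downarrow K[e] = \sum_{1 \leq i \leq t} W(m_i) \perp \sum_{1 \leq j \leq t'} W_{k_j}(\ell_j) \perp \sum_{1 \leq r \leq t''} V(2d_r).$$ Denote by $\alpha \geq 0$ the largest integer such that $2^{\alpha} \mid m_i,\ell_j,2d_r$ for all $i$, $j$, and $r$. Then $$\mathfrak{g}_{sc} \cong W_{2^{\alpha}} \oplus V' \quad\text{and}\quad \mathfrak{g}_{sc}/Z(\mathfrak{g}_{sc}) \cong W_{2^{\alpha}-1} \oplus V'$$ for some $K[e]$-module $V'$.
   Context: $K$ is an algebraically closed field of characteristic two. $V$ is a $K$-vector space of dimension $2\ell$ with a non-degenerate alternating bilinear form $b$; $\mathfrak{g}_{sc} = \mathfrak{sp}(V)$ with center $Z(\mathfrak{g}_{sc})$, acting on itself by $\mathrm{ad}$. $K[e]$ is the 2-Lie algebra generated by $e$ (spanned by $e, e^2, e^4,\dots$). $W_d$ denotes the $d$-dimensional $K[e]$-module on which $e$ acts as a single $d\times d$ nilpotent Jordan block; $W_0=0$. Every nilpotent $e\in\mathfrak{sp}(V)$ admits a decomposition of $V$ as an orthogonal direct sum of $e$-invariant subspaces, each isomorphic (by an $e$-equivariant isometry) to one of the following bilinear modules; $V \downarrow K[e] = \sum W(m_i)\perp\sum W_{k_j}(\ell_j)\perp\sum V(2d_r)$ denotes such a decomposition (some of the sums possibly empty). In all definitions the space has basis $v_1,\dots,v_n$, $n=2m$, with $b(v_i,v_j)=1$ if $i+j=n+1$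 and $0$ otherwise. - $V(2m)$, $m\ge1$: $ev_1=0$; $ev_i=v_{i-1}$ for $1<i\le n$. - $W(m)$, $m\ge1$: $ev_1=0$; $ev_i=v_{i-1}$ for $1<i\le m$; $ev_{m+1}=0$; $ev_i=v_{i-1}$ for $m+1<i\le n$. - $W_k(m)$, $0<k<m/2$: $ev_1=0$; $ev_{m+1}=0$; $ev_{n-k+1}=v_{n-k}+v_k$; $ev_i=v_{i-1}$ for all $i\notin\{1,m+1,n-k+1\}$. *)

theory Defs
  imports "HOL-Computational_Algebra.Polynomial"
begin

section \<open>The symplectic Lie algebra\<close>

locale symplectic_space = vector_space scale
  for scale :: "'k::field \<Rightarrow> 'v::ab_group_add \<Rightarrow> 'v" +
  fixes b :: "'v \<Rightarrow> 'v \<Rightarrow> 'k"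
  assumes finite_dim: "\<exists>B. finite B \<and> span B = UNIV"
    and linear_left: "Vector_Spaces.linear scale (*) (\<lambda>v. b v w)"
    and linear_right: "Vector_Spaces.linear scale (*) (\<lambda>w. b v w)"
    and alternating: "b v v = 0"
    and nondegenerate: "(\<And>w. b v w = 0) \<Longrightarrow> v = 0"

definition sp :: "('k::field \<Rightarrow> 'v::ab_group_add \<Rightarrow> 'v) \<Rightarrow> ('v \<Rightarrow> 'v \<Rightarrow> 'k) \<Rightarrow> ('v \<Rightarrow> 'v) set" where
  "sp scale b = {x. Vector_Spaces.linear scale scale x \<and> (\<forall>v w. b (x v) w + b v (x w) = 0)}"

definition lie_bracket :: "('v::ab_group_add \<Rightarrow> 'v) \<Rightarrow> ('v \<Rightarrow> 'v) \<Rightarrow> 'v \<Rightarrow> 'v" where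
  "lie_bracket x y = (\<lambda>v. x (y v) - y (x v))"

definition lie_center :: "('v::ab_group_add \<Rightarrow> 'v) set \<Rightarrow> ('v \<Rightarrow> 'v) set" where
  "lie_center L = {z \<in> L. \<forall>x\<in>L. lie_bracket z x = (\<lambda>v. 0)}"

definition nilpotent_map :: "('v::zero \<Rightarrow> 'v) \<Rightarrow> bool" where
  "nilpotent_map e \<longleftrightarrow> (\<exists>N. e ^^ N = (\<lambda>v. 0))"


section \<open>Modules for the 2-Lie algebra generated by \<open>e\<close>\<close>

text \<open>
  A module for the 2-Lie algebra $K[e]$ is determined by the operator \<open>act\<close> by which the
  generator \<open>e\<close> acts: the 2-power map of $K[e]$ is squaring, so $e^{2^i}$ acts as the
  $2^i$-th power of \<open>act\<close>, and a linear map between two modules is $K[e]$-linear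
  iff it commutes with \<open>act\<close>.  Explicit carriers and operations are used because of quotients.
\<close>

record ('k, 'a) op_module =
  carrier :: "'a set"
  zero :: "'a"
  add :: "'a \<Rightarrow> 'a \<Rightarrow> 'a"
  smult :: "'k \<Rightarrow> 'a \<Rightarrow> 'a"
  act :: "'a \<Rightarrow> 'a"

definition op_module :: "('k::field, 'a) op_module \<Rightarrow> bool" where
  "op_module M \<longleftrightarrow>
     zero M \<in> carrier M \<and>
     (\<forall>x\<in>carrier M. \<forall>y\<in>carrier M. add M x y \<in> carrier M) \<and>
     (\<forall>c. \<forall>x\<in>carrier M. smult M c x \<in> carrier M) \<and>
     (\<forall>x\<in>carrier M. \<forall>y\<in>carrier M. \<forall>z\<in>carrier M. add M (add M x y) z = add M x (add M y z)) \<and>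
     (\<forall>x\<in>carrier M. \<forall>y\<in>carrier M. add M x y = add M y x) \<and>
     (\<forall>x\<in>carrier M. add M (zero M) x = x) \<and>
     (\<forall>x\<in>carrier M. \<exists>y\<in>carrier M. add M x y = zero M) \<and>
     (\<forall>c. \<forall>x\<in>carrier M. \<forall>y\<in>carrier M.
        smult M c (add M x y) = add M (smult M c x) (smult M c y)) \<and>
     (\<forall>c d. \<forall>x\<in>carrier M. smult M (c + d) x = add M (smult M c x) (smult M d x)) \<and>
     (\<forall>c d. \<forall>x\<in>carrier M. smult M (c * d) x = smult M c (smult M d x)) \<and>
     (\<forall>x\<in>carrier M. smult M 1 x = x) \<and>
     (\<forall>x\<in>carrier M. act M x \<in> carrier M) \<and>
     (\<forall>x\<in>carrier M. \<forall>y\<in>carrier M. act M (add M x y) = add M (act M x) (act M y)) \<and>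
     (\<forall>c. \<forall>x\<in>carrier M. act M (smult M c x) = smult M c (act M x))"

text \<open>
  The second conjunct says that the action of $K[e]$ is well defined: for nilpotent \<open>e\<close> the
  nonzero elements among $e, e^2, e^4, \ldots$ are a basis of $K[e]$.
\<close>

definition ke_module :: "('v::zero \<Rightarrow> 'v) \<Rightarrow> ('k::field, 'a) op_module \<Rightarrow> bool" where
  "ke_module e M \<longleftrightarrow> op_module M \<and>
     (\<forall>i::nat. e ^^ (2 ^ i) = (\<lambda>v. 0) \<longrightarrow> (\<forall>x\<in>carrier M. (act M ^^ (2 ^ i)) x = zero M))"

definition module_iso :: "('k, 'a) op_module \<Rightarrow> ('k, 'c) op_module \<Rightarrow> bool" where
  "module_iso M N \<longleftrightarrow> (\<exists>\<phi>. bij_betw \<phi> (carrier M) (carrier N) \<and>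
     (\<forall>x\<in>carrier M. \<forall>y\<in>carrier M. \<phi> (add M x y) = add N (\<phi> x) (\<phi> y)) \<and>
     (\<forall>c. \<forall>x\<in>carrier M. \<phi> (smult M c x) = smult N c (\<phi> x)) \<and>
     (\<forall>x\<in>carrier M. \<phi> (act M x) = act N (\<phi> x)))"

definition direct_sum ::
  "('k, 'a) op_module \<Rightarrow> ('k, 'c) op_module \<Rightarrow> ('k, 'a \<times> 'c) op_module" where
  "direct_sum M N = \<lparr>
     carrier = carrier M \<times> carrier N,
     zero = (zero M, zero N),
     add = (\<lambda>x y. (add M (fst x) (fst y), add N (snd x) (snd y))),
     smult = (\<lambda>c x. (smult M c (fst x), smult N c (snd x))),
     act = (\<lambda>x. (act M (fst x), act N (snd x)))\<rparr>"

definition coset :: "('k, 'a) op_module \<Rightarrow> 'a set \<Rightarrow> 'a \<Rightarrow> 'a set" where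
  "coset M Z x = {add M x z | z. z \<in> Z}"

text \<open>Adding \<open>Z\<close> in the last two operations matters: \<open>{smult M 0 x | x. x \<in> A}\<close> is not a coset.\<close>

definition quotient_module :: "('k, 'a) op_module \<Rightarrow> 'a set \<Rightarrow> ('k, 'a set) op_module" where
  "quotient_module M Z = \<lparr>
     carrier = coset M Z ` carrier M,
     zero = coset M Z (zero M),
     add = (\<lambda>A B. {add M x y | x y. x \<in> A \<and> y \<in> B}),
     smult = (\<lambda>c A. {add M (smult M c x) z | x z. x \<in> A \<and> z \<in> Z}),
     act = (\<lambda>A. {add M (act M x) z | x z. x \<in> A \<and> z \<in> Z})\<rparr>"

text \<open>
  The standard basis vectors $w_0, \ldots, w_{d-1}$ are the indicator functions of $0, \ldots, d-1$;
  the operator sends $w_0$ to $0$ and $w_{i+1}$ to $w_i$.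
\<close>

definition W_module :: "nat \<Rightarrow> ('k::field, nat \<Rightarrow> 'k) op_module" where
  "W_module d = \<lparr>
     carrier = {f. \<forall>i\<ge>d. f i = 0},
     zero = (\<lambda>i. 0),
     add = (\<lambda>f g i. f i + g i),
     smult = (\<lambda>c f i. c * f i),
     act = (\<lambda>f i. f (Suc i))\<rparr>"

definition sp_module :: "('k::field \<Rightarrow> 'v::ab_group_add \<Rightarrow> 'v) \<Rightarrow> ('v \<Rightarrow> 'v \<Rightarrow> 'k)
    \<Rightarrow> ('v \<Rightarrow> 'v) \<Rightarrow> ('k, 'v \<Rightarrow> 'v) op_module" where
  "sp_module scale b e = \<lparr>
     carrier = sp scale b,
     zero = (\<lambda>v. 0),
     add = (\<lambda>x y v. x v + y v),
     smult = (\<lambda>c x v. scale c (x v)),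
     act = lie_bracket e\<rparr>"


section \<open>Orthogonal decompositions\<close>

text \<open>\<open>BW m\<close>, \<open>BWk k m\<close> and \<open>BV m\<close> stand for $W(m)$, $W_k(m)$ and $V(2m)$.\<close>

datatype block = BW nat | BWk nat nat | BV nat

fun block_wf :: "block \<Rightarrow> bool" where
  "block_wf (BW m) \<longleftrightarrow> 1 \<le> m"
| "block_wf (BWk k m) \<longleftrightarrow> 0 < k \<and> 2 * k < m"
| "block_wf (BV m) \<longleftrightarrow> 1 \<le> m"

fun block_dim :: "block \<Rightarrow> nat" where
  "block_dim (BW m) = 2 * m"
| "block_dim (BWk k m) = 2 * m"
| "block_dim (BV m) = 2 * m"

text \<open>\<open>block_act B v i\<close> is the image of the basis vector \<open>v i\<close>, where \<open>1 \<le> i \<le> block_dim B\<close>.\<close>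

fun block_act :: "block \<Rightarrow> (nat \<Rightarrow> 'v::ab_group_add) \<Rightarrow> nat \<Rightarrow> 'v" where
  "block_act (BW m) v i = (if i = 1 \<or> i = m + 1 then 0 else v (i - 1))"
| "block_act (BWk k m) v i =
     (if i = 1 \<or> i = m + 1 then 0
      else if i = 2 * m - k + 1 then v (2 * m - k) + v k
      else v (i - 1))"
| "block_act (BV m) v i = (if i = 1 then 0 else v (i - 1))"

text \<open>
  \<open>U\<close>, with \<open>b\<close> and \<open>e\<close> restricted to it, is isometric to the block \<open>B\<close> by an \<open>e\<close>-equivariant
  isometry; the \<open>v i\<close> are the images of the defining basis of the block.
\<close>

definition isometric_to_block :: "('k::field \<Rightarrow> 'v::ab_group_add \<Rightarrow> 'v) \<Rightarrow> ('v \<Rightarrow> 'v \<Rightarrow> 'k)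
    \<Rightarrow> ('v \<Rightarrow> 'v) \<Rightarrow> 'v set \<Rightarrow> block \<Rightarrow> bool" where
  "isometric_to_block scale b e U B \<longleftrightarrow> block_wf B \<and>
     (\<exists>v. inj_on v {1..block_dim B} \<and>
          \<not> module.dependent scale (v ` {1..block_dim B}) \<and>
          module.span scale (v ` {1..block_dim B}) = U \<and>
          (\<forall>i\<in>{1..block_dim B}. \<forall>j\<in>{1..block_dim B}.
             b (v i) (v j) = (if i + j = block_dim B + 1 then 1 else 0)) \<and>
          (\<forall>i\<in>{1..block_dim B}. e (v i) = block_act B v i))"

definition orthogonal_decomposition :: "('k::field \<Rightarrow> 'v::ab_group_add \<Rightarrow> 'v) \<Rightarrow> ('v \<Rightarrow> 'v \<Rightarrow> 'k)
    \<Rightarrow> ('v \<Rightarrow> 'v) \<Rightarrow> block list \<Rightarrow> bool" where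
  "orthogonal_decomposition scale b e Bs \<longleftrightarrow>
     (\<exists>U. (\<forall>i<length Bs. module.subspace scale (U i) \<and> e ` U i \<subseteq> U i \<and>
                          isometric_to_block scale b e (U i) (Bs ! i)) \<and>
          (\<forall>i<length Bs. \<forall>j<length Bs. i \<noteq> j \<longrightarrow> (\<forall>x\<in>U i. \<forall>y\<in>U j. b x y = 0)) \<and>
          (\<forall>x. \<exists>!u. (\<forall>i<length Bs. u i \<in> U i) \<and> (\<forall>i\<ge>length Bs. u i = 0) \<and>
                    x = (\<Sum>i<length Bs. u i)))"

end

theory Submission
  imports Defs
begin

text \<open>
  Let $N = \mathrm{ad}(e)$ and $q = 2^\alpha$.  If $1 = N^{q-1} x$ but $1 \notin \mathrm{im}\, N^q$, then a
  functional \<open>f\<close> with $f(1) = 1$ and $f(\mathrm{im}\, N^q) = 0$ makes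
  $\{y.\ f(N^i y) = 0 \mbox{ for all } i\}$ a complement of the Jordan block
  $\langle x, N x, \ldots, N^{q-1} x = 1\rangle$, and the centre consists of the scalars, so it is the
  socle of that block.

  In characteristic 2, $N^q y = [e^q, y]$ and $N^{q-1} y = \sum_{i+j=q-1} e^i y e^j$.  Under
  $\mathfrak{gl}(V) = V \otimes V$ the latter is multiplication by $\sum_{i+j=q-1} X^i Y^j$, which
  divides $\sum_{i+j=s-1} X^i Y^j$ when $q$ divides $s$; since the identity of each block is
  (a symmetrization of) such a sum applied to generators, it lies in the image of $N^{q-1}$.
  Conversely, if $s = q r$ is a block size with $r$ odd and $1 = [e^q, y]$, then
  $[e^s, y] = r e^{s-q}$, so that $e^{s-1}$ maps $\ker e^s$ into $\mathrm{im}\, e^s$, which the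
  block of size $s$ contradicts.
\<close>

section \<open>Calculus in characteristic two\<close>

lemma sum_lessThan_add:
  fixes f :: "nat \<Rightarrow> 'a::comm_monoid_add"
  shows "(\<Sum>i<m + n. f i) = (\<Sum>i<m. f i) + (\<Sum>i<n. f (m + i))"
  by (induction n) (simp_all add: add.assoc)

locale char2_symplectic = symplectic_space scale b
  for scale :: "'k::field \<Rightarrow> 'v::ab_group_add \<Rightarrow> 'v" and b :: "'v \<Rightarrow> 'v \<Rightarrow> 'k" +
  fixes e :: "'v \<Rightarrow> 'v"
  assumes char2: "CHAR('k) = 2"
    and e_sp: "e \<in> sp scale b"
begin

section \<open>Arithmetic without signs\<close>

lemma scalar_add_self [simp]: "(c::'k) + c = 0"
proof -
  have "(of_nat 2 :: 'k) = 0"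
    using of_nat_eq_0_iff_char_dvd[of 2, where ?'a = 'k] char2 by simp
  then have "c * (1 + 1) = 0"
    by simp
  then show ?thesis
    by (simp add: algebra_simps)
qed

lemma scalar_minus [simp]: "- (c::'k) = c"
  using scalar_add_self[of c] by (simp add: minus_unique)

lemma vector_minus [simp]: "- (x::'v) = x"
proof -
  have "- x = scale (- 1) x"
    by (simp only: scale_minus_left scale_one)
  also have "\<dots> = scale 1 x"
    by (simp only: scalar_minus)
  finally show ?thesis
    by simp
qed

lemma vector_add_self [simp]: "(x::'v) + x = 0"
  using vector_minus[of x] by (metis add.right_inverse)

lemma vector_diff: "(x::'v) - y = x + y"
  by (metis diff_conv_add_uminus vector_minus)

lemma of_nat_odd: "odd n \<Longrightarrow> (of_nat n :: 'k) = 1"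
  by (elim oddE) (simp add: mult_2)

lemma linear_scale_iff:
  "Vector_Spaces.linear scale scale y \<longleftrightarrow>
    (\<forall>u v. y (u + v) = y u + y v) \<and> (\<forall>c v. y (scale c v) = scale c (y v))"
  using vector_space_axioms by (auto simp: Vector_Spaces.linear_iff)

lemma b_left: "b (x + y) z = b x z + b y z" "b (scale c x) z = c * b x z" "b 0 z = 0"
  "b (\<Sum>i\<in>I. f i) z = (\<Sum>i\<in>I. b (f i) z)"
proof -
  interpret Vector_Spaces.linear scale "(*)" "\<lambda>x. b x z"
    by (rule linear_left)
  show "b (x + y) z = b x z + b y z" "b (scale c x) z = c * b x z" "b 0 z = 0"
    "b (\<Sum>i\<in>I. f i) z = (\<Sum>i\<in>I. b (f i) z)"
    by (simp_all add: add scale zero sum)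
qed

lemma b_right: "b x (y + z) = b x y + b x z" "b x (scale c y) = c * b x y" "b x 0 = 0"
  "b x (\<Sum>i\<in>I. f i) = (\<Sum>i\<in>I. b x (f i))"
proof -
  interpret Vector_Spaces.linear scale "(*)" "\<lambda>y. b x y"
    by (rule linear_right)
  show "b x (y + z) = b x y + b x z" "b x (scale c y) = c * b x y" "b x 0 = 0"
    "b x (\<Sum>i\<in>I. f i) = (\<Sum>i\<in>I. b x (f i))"
    by (simp_all add: add scale zero sum)
qed

lemma b_commute: "b x y = b y x"
proof -
  have "b x y + b y x = b (x + y) (x + y)"
    unfolding b_left b_right by (simp add: alternating)
  then have "b x y + b y x = 0"
    by (simp only: alternating)
  then show ?thesis
    by (metis add_eq_0_iff scalar_minus)
qed

text \<open>Since signs vanish, the defining condition of \<open>sp\<close> becomes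
  self-adjointness. This is why scalars belong to \<open>sp\<close> and why powers of
  \<open>e\<close> move freely across the form.\<close>

lemma sp_iff:
  "y \<in> sp scale b \<longleftrightarrow> Vector_Spaces.linear scale scale y \<and> (\<forall>u v. b (y u) v = b u (y v))"
  unfolding sp_def by (auto simp: add_eq_0_iff)

lemma sp_linear:
  assumes "y \<in> sp scale b"
  shows "y (u + v) = y u + y v" "y (scale c v) = scale c (y v)" "y 0 = 0"
    "y (\<Sum>i\<in>I. f i) = (\<Sum>i\<in>I. y (f i))"
proof -
  interpret Vector_Spaces.linear scale scale y
    using assms by (simp add: sp_def)
  show "y (u + v) = y u + y v" "y (scale c v) = scale c (y v)" "y 0 = 0"
    "y (\<Sum>i\<in>I. f i) = (\<Sum>i\<in>I. y (f i))"
    by (simp_all add: add scale zero sum)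
qed

lemma sp_adjoint: "y \<in> sp scale b \<Longrightarrow> b (y u) v = b u (y v)"
  by (simp add: sp_iff)

lemma sp_lincomb:
  assumes "\<And>i. i \<in> I \<Longrightarrow> y i \<in> sp scale b"
  shows "(\<lambda>v. \<Sum>i\<in>I. scale (c i) (y i v)) \<in> sp scale b"
  using assms unfolding sp_iff linear_scale_iff
  by (simp add: b_left b_right scale_right_distrib sum.distrib scale_sum_right mult.commute)

lemma sp_add: "x \<in> sp scale b \<Longrightarrow> y \<in> sp scale b \<Longrightarrow> (\<lambda>v. x v + y v) \<in> sp scale b"
  unfolding sp_iff linear_scale_iff by (simp add: b_left b_right scale_right_distrib)

lemma sp_smult: "x \<in> sp scale b \<Longrightarrow> (\<lambda>v. scale c (x v)) \<in> sp scale b"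
  unfolding sp_iff linear_scale_iff
  by (simp add: b_left b_right scale_right_distrib scale_left_commute)

lemma sp_scalar: "(\<lambda>v. scale c v) \<in> sp scale b"
  unfolding sp_iff linear_scale_iff
  by (simp add: b_left b_right scale_right_distrib scale_left_commute)

lemma sp_zero: "(\<lambda>v. 0) \<in> sp scale b"
  using sp_scalar[of 0] by simp

lemma e_linear: "e (u + v) = e u + e v" "e (scale c v) = scale c (e v)" "e 0 = 0"
    "e (\<Sum>i\<in>I. f i) = (\<Sum>i\<in>I. e (f i))"
  by (rule sp_linear[OF e_sp])+

lemma e_pow_linear: "(e ^^ n) (u + v) = (e ^^ n) u + (e ^^ n) v"
    "(e ^^ n) (scale c v) = scale c ((e ^^ n) v)" "(e ^^ n) 0 = 0"
    "(e ^^ n) (\<Sum>i\<in>I. f i) = (\<Sum>i\<in>I. (e ^^ n) (f i))"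
  by (induction n) (simp_all add: e_linear)

lemma e_pow_adjoint: "b ((e ^^ n) u) v = b u ((e ^^ n) v)"
  by (induction n arbitrary: u v) (simp_all add: sp_adjoint[OF e_sp] funpow_swap1)

lemma e_pow_pow: "(e ^^ i) ((e ^^ j) v) = (e ^^ (i + j)) v"
  by (simp add: funpow_add)

lemma e_pow_zero: "(e ^^ i) v = 0 \<Longrightarrow> i \<le> j \<Longrightarrow> (e ^^ j) v = 0"
  by (metis e_pow_linear(3) e_pow_pow le_add_diff_inverse2)

subsection \<open>The adjoint action\<close>

abbreviation ad :: "('v \<Rightarrow> 'v) \<Rightarrow> 'v \<Rightarrow> 'v" where
  "ad \<equiv> lie_bracket e"

lemma ad_eq: "ad y = (\<lambda>v. e (y v) + y (e v))"
  by (simp add: lie_bracket_def vector_diff)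

lemma ad_sp: "y \<in> sp scale b \<Longrightarrow> ad y \<in> sp scale b"
  using e_sp unfolding ad_eq sp_iff linear_scale_iff
  by (simp add: b_left b_right scale_right_distrib algebra_simps)

lemma ad_pow_sp: "y \<in> sp scale b \<Longrightarrow> (ad ^^ n) y \<in> sp scale b"
  by (induction n) (simp_all add: ad_sp)

lemma ad_pow_lincomb:
  "(ad ^^ n) (\<lambda>v. \<Sum>i\<in>I. scale (c i) (y i v)) = (\<lambda>v. \<Sum>i\<in>I. scale (c i) ((ad ^^ n) (y i) v))"
  by (induction n)
    (simp_all add: ad_eq e_linear sum.distrib scale_right_distrib)

lemma ad_pow_add: "(ad ^^ n) (\<lambda>v. x v + y v) = (\<lambda>v. (ad ^^ n) x v + (ad ^^ n) y v)"
  by (induction n) (simp_all add: ad_eq e_linear algebra_simps)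

lemma ad_pow_smult: "(ad ^^ n) (\<lambda>v. scale c (y v)) = (\<lambda>v. scale c ((ad ^^ n) y v))"
  by (induction n) (simp_all add: ad_eq e_linear scale_right_distrib)

lemma ad_pow_0: "(ad ^^ n) (\<lambda>v. 0) = (\<lambda>v. 0)"
  using ad_pow_smult[of n 0] by simp

lemma ad_id: "ad (\<lambda>v. v) = (\<lambda>v. 0)"
  by (simp add: ad_eq)

text \<open>\<open>ad\<close> is the sum of left and right multiplication by \<open>e\<close>. These
  commute, so under repeated squaring in characteristic two the mixed terms cancel and only the two
  pure powers survive.\<close>

lemma ad_pow2: "(ad ^^ (2 ^ n)) y = (\<lambda>v. (e ^^ (2 ^ n)) (y v) + y ((e ^^ (2 ^ n)) v))"
proof (induction n arbitrary: y)
  case (Suc n)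
  have "(ad ^^ (2 ^ Suc n)) y = (ad ^^ (2 ^ n)) ((ad ^^ (2 ^ n)) y)"
    by (simp add: funpow_add mult_2)
  also have "\<dots> = (\<lambda>v. (e ^^ (2 ^ Suc n)) (y v) + y ((e ^^ (2 ^ Suc n)) v))"
    by (simp add: Suc e_pow_linear e_pow_pow mult_2 algebra_simps)
  finally show ?case .
qed (simp add: ad_eq)

text \<open>All binomial coefficients $\binom{2^n-1}{i}$ are odd.\<close>

lemma ad_pow2_minus_1:
  "(ad ^^ (2 ^ n - 1)) y = (\<lambda>v. \<Sum>i<2 ^ n. (e ^^ i) (y ((e ^^ (2 ^ n - 1 - i)) v)))"
proof (induction n)
  case (Suc n)
  let ?q = "2 ^ n :: nat"
  have "(ad ^^ (2 ^ Suc n - 1)) y = (ad ^^ ?q) ((ad ^^ (?q - 1)) y)"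
  proof -
    have "2 ^ Suc n - 1 = ?q + (?q - 1)"
      by (simp add: mult_2)
    then show ?thesis
      by (simp only: funpow_add o_apply)
  qed
  \<comment> \<open>A further power of exponent \<open>?q\<close> on the left gives the indices from
    \<open>?q\<close> to \<open>2 * ?q - 1\<close>; on the right it gives those below
    \<open>?q\<close>.\<close>
  also have "\<dots> = (\<lambda>v. (\<Sum>i<?q. (e ^^ (?q + i)) (y ((e ^^ (?q - 1 - i)) v))) +
      (\<Sum>i<?q. (e ^^ i) (y ((e ^^ (2 * ?q - 1 - i)) v))))"
    unfolding ad_pow2 Suc
    by (intro ext arg_cong2[where f = "(+)"] sum.cong)
      (auto simp: e_pow_linear e_pow_pow intro!: sum.cong arg_cong[where f = y]
        arg_cong2[where f = "\<lambda>i. e ^^ i"] arg_cong[where f = "\<lambda>i. (e ^^ i) _"])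
  also have "\<dots> = (\<lambda>v. \<Sum>i<2 ^ Suc n. (e ^^ i) (y ((e ^^ (2 ^ Suc n - 1 - i)) v)))"
  proof
    fix v
    have "(\<Sum>i<?q + ?q. (e ^^ i) (y ((e ^^ (2 * ?q - 1 - i)) v))) =
      (\<Sum>i<?q. (e ^^ i) (y ((e ^^ (2 * ?q - 1 - i)) v))) +
      (\<Sum>i<?q. (e ^^ (?q + i)) (y ((e ^^ (?q - 1 - i)) v)))"
      unfolding sum_lessThan_add by (simp add: mult_2)
    then show "(\<Sum>i<?q. (e ^^ (?q + i)) (y ((e ^^ (?q - 1 - i)) v))) +
      (\<Sum>i<?q. (e ^^ i) (y ((e ^^ (2 * ?q - 1 - i)) v))) =
      (\<Sum>i<2 ^ Suc n. (e ^^ i) (y ((e ^^ (2 ^ Suc n - 1 - i)) v)))"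
      by (simp add: mult_2 add.commute)
  qed
  finally show ?case .
qed simp

subsection \<open>Sums of rank one operators\<close>

text \<open>Identifying $V \otimes V$ with $\mathfrak{gl}(V)$ through \<open>b\<close>, this is
  $\sum_{a+c=s-1} g^a p \otimes g^c r$.\<close>

definition conv :: "nat \<Rightarrow> ('v \<Rightarrow> 'v) \<Rightarrow> 'v \<Rightarrow> 'v \<Rightarrow> 'v \<Rightarrow> 'v" where
  "conv s g p r x = (\<Sum>a<s. scale (b x ((g ^^ a) p)) ((g ^^ (s - 1 - a)) r))"

lemma conv_linear: "Vector_Spaces.linear scale scale (conv s g p r)"
  unfolding linear_scale_iff conv_def
  by (simp add: b_left scale_left_distrib sum.distrib scale_sum_right)

text \<open>The adjoint of a rank one operator has its two factors swapped; reversing the order of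
  summation restores the shape. So \<open>conv\<close> is self-adjoint for equal factors, and
  becomes so after symmetrization otherwise.\<close>

lemma conv_adjoint: "b (conv s g p r x) y = b x (conv s g r p y)"
proof -
  have "b x (conv s g r p y) = (\<Sum>a<s. b y ((g ^^ a) r) * b x ((g ^^ (s - 1 - a)) p))"
    by (simp add: conv_def b_right)
  also have "\<dots> = (\<Sum>a<s. b y ((g ^^ (s - Suc a)) r) * b x ((g ^^ (s - 1 - (s - Suc a))) p))"
    by (rule sum.nat_diff_reindex[symmetric])
  also have "\<dots> = b (conv s g p r x) y"
    unfolding conv_def b_left by (intro sum.cong) (auto simp: b_commute[of y])
  finally show ?thesis ..
qed

lemma conv_sp: "conv s g p p \<in> sp scale b"
  by (simp add: sp_iff conv_linear conv_adjoint)

lemma conv_sym_sp: "(\<lambda>x. conv s g p r x + conv s g r p x) \<in> sp scale b"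
  using conv_linear[of s g p r] conv_linear[of s g r p] unfolding sp_iff linear_scale_iff
  by (simp add: scale_right_distrib b_left b_right conv_adjoint algebra_simps)

text \<open>With q for \<open>2 ^ n\<close>, this is a polynomial identity: the sum of X^i Y^j over
  i + j = q - 1, times the sum of X^(qa) Y^(qc) over a + c = s - 1, is the sum over i + j = sq - 1.
  Division with remainder by q reaches each exponent below sq exactly once.\<close>

lemma ad_pow_conv: "(ad ^^ (2 ^ n - 1)) (conv s (e ^^ (2 ^ n)) p r) = conv (s * 2 ^ n) e p r"
proof
  fix x
  define q :: nat where "q = 2 ^ n"
  have q: "q > 0"
    by (simp add: q_def)
  let ?h = "\<lambda>c. scale (b x ((e ^^ c) p)) ((e ^^ (s * q - 1 - c)) r)"
  \<comment> \<open>The two exponents in each term must add up to \<open>s * q - 1\<close>; the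
    bounds keep the truncated subtractions honest.\<close>
  have exp: "i + q * (s - 1 - a) = s * q - 1 - (q - 1 - i + q * a)" if "i < q" "a < s" for a i
  proof -
    have "s = Suc (s - 1 - a) + a"
      using that by simp
    then have "s * q = q * (s - 1 - a) + q + q * a"
      by (metis add.commute add_mult_distrib2 mult.commute mult_Suc_right)
    then show ?thesis
      using that by simp
  qed
  have "(ad ^^ (q - 1)) (conv s (e ^^ q) p r) x =
    (\<Sum>i<q. \<Sum>a<s. ?h (q - 1 - i + q * a))"
    unfolding q_def ad_pow2_minus_1
    unfolding q_def[symmetric]
  proof (intro sum.cong refl)
    fix i
    assume "i \<in> {..<q}"
    then show "(e ^^ i) (conv s (e ^^ q) p r ((e ^^ (q - 1 - i)) x)) = (\<Sum>a<s. ?h (q - 1 - i + q * a))"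
      unfolding conv_def e_pow_linear funpow_mult e_pow_adjoint e_pow_pow
      by (intro sum.cong refl) (simp only: exp lessThan_iff)
  qed
  also have "\<dots> = (\<Sum>i<q. \<Sum>a<s. ?h (i + q * a))"
    using sum.nat_diff_reindex[of "\<lambda>i. \<Sum>a<s. ?h (i + q * a)" q] by simp
  also have "\<dots> = (\<Sum>a<s. \<Sum>i<q. ?h (i + q * a))"
    by (rule sum.swap)
  \<comment> \<open>For fixed \<open>a\<close> the exponents fill an interval of length
    \<open>q\<close>, and these intervals tile the range below \<open>s * q\<close>.\<close>
  also have "\<dots> = (\<Sum>a<s. sum ?h {a * q..<a * q + q})"
  proof (rule sum.cong[OF refl])
    fix a
    show "(\<Sum>i<q. ?h (i + q * a)) = sum ?h {a * q..<a * q + q}"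
      by (rule sum.reindex_bij_witness[of _ "\<lambda>c. c - q * a" "\<lambda>i. i + q * a"])
        (auto simp: mult.commute)
  qed
  also have "\<dots> = conv (s * q) e p r x"
    unfolding sum.nat_group conv_def ..
  finally show "(ad ^^ (2 ^ n - 1)) (conv s (e ^^ (2 ^ n)) p r) x = conv (s * 2 ^ n) e p r x"
    by (simp add: q_def)
qed

text \<open>Applying \<open>e\<close> to the result raises the exponent on \<open>r\<close>, while
  applying it to the argument raises the exponent on \<open>p\<close>, by self-adjointness. The
  difference telescopes to two boundary terms, which contain the s-th powers that vanish by
  assumption.\<close>

lemma conv_commute:
  assumes "(e ^^ s) p = 0" "(e ^^ s) r = 0"
  shows "e (conv s e p r x) = conv s e p r (e x)"
proof -
  define h where "h a = scale (b x ((e ^^ a) p)) ((e ^^ (s - a)) r)" for a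
  have "e (conv s e p r x) - conv s e p r (e x) = (\<Sum>a<s. h a - h (Suc a))"
    unfolding conv_def e_linear sum_subtractf[symmetric] h_def
  proof (intro sum.cong refl arg_cong2[where f = "(-)"])
    fix a
    assume "a \<in> {..<s}"
    then have "s - a = Suc (s - 1 - a)"
      by simp
    then show "scale (b x ((e ^^ a) p)) (e ((e ^^ (s - 1 - a)) r)) =
        scale (b x ((e ^^ a) p)) ((e ^^ (s - a)) r)"
      by simp
  qed (simp add: sp_adjoint[OF e_sp])
  also have "\<dots> = h 0 - h s"
    by (rule sum_lessThan_telescope')
  also have "\<dots> = 0"
    using assms by (simp add: h_def b_right)
  finally show ?thesis
    by simp
qed

end

section \<open>Quotients and the center\<close>

text \<open>The homomorphism theorem for quotients whose elements are sets. The hypothesis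
  \<open>fibre\<close> plays the part of the kernel: it makes the induced map well defined and
  injective at once.\<close>

lemma quotient_module_iso:
  assumes fibre: "\<And>x. x \<in> carrier M \<Longrightarrow> coset M Z x = {y \<in> carrier M. \<phi> y = \<phi> x}"
    and add_closed: "\<And>x y. x \<in> carrier M \<Longrightarrow> y \<in> carrier M \<Longrightarrow> add M x y \<in> carrier M"
    and smult_closed: "\<And>c x. x \<in> carrier M \<Longrightarrow> smult M c x \<in> carrier M"
    and act_closed: "\<And>x. x \<in> carrier M \<Longrightarrow> act M x \<in> carrier M"
    and surj: "\<phi> ` carrier M = carrier N"
    and add: "\<And>x y. x \<in> carrier M \<Longrightarrow> y \<in> carrier M \<Longrightarrow> \<phi> (add M x y) = add N (\<phi> x) (\<phi> y)"
    and smult: "\<And>c x. x \<in> carrier M \<Longrightarrow> \<phi> (smult M c x) = smult N c (\<phi> x)"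
    and act: "\<And>x. x \<in> carrier M \<Longrightarrow> \<phi> (act M x) = act N (\<phi> x)"
  shows "module_iso (quotient_module M Z) N"
proof -
  \<comment> \<open>The choice of representative is harmless because \<open>\<phi>\<close> is
    constant on each coset.\<close>
  define \<psi> where "\<psi> A = \<phi> (SOME x. x \<in> A)" for A
  have \<psi>_eq: "\<psi> A = c" if "A \<noteq> {}" "\<And>x. x \<in> A \<Longrightarrow> \<phi> x = c" for A c
    unfolding \<psi>_def using that by (meson ex_in_conv someI_ex)
  have self: "x \<in> coset M Z x" if "x \<in> carrier M" for x
    using that by (simp add: fibre)
  have \<psi>_coset: "\<psi> (coset M Z x) = \<phi> x" if "x \<in> carrier M" for x
    using self[OF that] by (intro \<psi>_eq) (auto simp: fibre[OF that])
  have translate: "\<phi> (add M x z) = \<phi> x" if "x \<in> carrier M" "z \<in> Z" for x z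
  proof -
    have "add M x z \<in> coset M Z x"
      using that by (auto simp: coset_def)
    then show ?thesis
      by (simp add: fibre that)
  qed
  \<comment> \<open>The sets that define \<open>smult\<close> and \<open>act\<close> on the quotient
    range over \<open>Z\<close>; they must be inhabited before a value can be chosen from
    them.\<close>
  have Z_ne: "Z \<noteq> {}" if "x \<in> carrier M" for x
    using self[OF that] by (auto simp: coset_def)
  show ?thesis
    unfolding module_iso_def
  proof (intro exI[of _ \<psi>] conjI allI ballI)
    have "inj_on \<psi> (coset M Z ` carrier M)"
    proof (rule inj_onI, elim imageE)
      fix A B x y
      assume "\<psi> A = \<psi> B" and xy: "A = coset M Z x" "x \<in> carrier M" "B = coset M Z y" "y \<in> carrier M"
      then have "\<phi> x = \<phi> y"
        by (simp add: \<psi>_coset)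
      then show "A = B"
        using xy by (simp add: fibre)
    qed
    moreover have "\<psi> ` coset M Z ` carrier M = carrier N"
      unfolding surj[symmetric] image_image by (intro image_cong refl \<psi>_coset)
    ultimately show "bij_betw \<psi> (carrier (quotient_module M Z)) (carrier N)"
      by (simp add: bij_betw_def quotient_module_def)
  next
    fix A B
    assume "A \<in> carrier (quotient_module M Z)" "B \<in> carrier (quotient_module M Z)"
    then obtain x y where xy: "x \<in> carrier M" "y \<in> carrier M"
      and AB: "A = coset M Z x" "B = coset M Z y"
      by (auto simp: quotient_module_def)
    have "\<psi> {add M x' y' |x' y'. x' \<in> A \<and> y' \<in> B} = add N (\<phi> x) (\<phi> y)"
      using self xy by (intro \<psi>_eq) (auto simp: AB fibre add)
    then show "\<psi> (add (quotient_module M Z) A B) = add N (\<psi> A) (\<psi> B)"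
      by (simp add: quotient_module_def AB \<psi>_coset xy)
  next
    fix c A
    assume "A \<in> carrier (quotient_module M Z)"
    then obtain x where x: "x \<in> carrier M" and A: "A = coset M Z x"
      by (auto simp: quotient_module_def)
    have "\<psi> {add M (smult M c x') z |x' z. x' \<in> A \<and> z \<in> Z} = smult N c (\<phi> x)"
      using x Z_ne[OF x]
      by (intro \<psi>_eq) (auto simp: A fibre smult translate smult_closed)
    then show "\<psi> (smult (quotient_module M Z) c A) = smult N c (\<psi> A)"
      by (simp add: quotient_module_def A \<psi>_coset x)
    have "\<psi> {add M (act M x') z |x' z. x' \<in> A \<and> z \<in> Z} = act N (\<phi> x)"
      using x Z_ne[OF x]
      by (intro \<psi>_eq) (auto simp: A fibre act translate act_closed)
    then show "\<psi> (act (quotient_module M Z) A) = act N (\<psi> A)"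
      by (simp add: quotient_module_def A \<psi>_coset x)
  qed
qed

context char2_symplectic
begin

lemma nonzero_pairing:
  assumes "p \<noteq> 0"
  obtains x where "b x p = 1"
proof -
  obtain w where w: "b p w \<noteq> 0"
    using nondegenerate[of p] assms by blast
  have "b (scale (1 / b p w) w) p = 1"
    using w by (simp add: b_left b_commute[of w p])
  then show ?thesis
    using that by blast
qed

text \<open>Commuting with the rank one operators sending x to b(x,p) p forces every nonzero p to be
  an eigenvector. Comparing the eigenvalues at p, v and p + v then shows that there is only
  one.\<close>

lemma center_sp: "lie_center (sp scale b) = range scale"
proof (intro equalityI subsetI)
  fix z
  assume "z \<in> range scale"
  then obtain c where z: "z = (\<lambda>v. scale c v)"
    by auto
  show "z \<in> lie_center (sp scale b)"
    unfolding lie_center_def lie_bracket_def z using sp_scalar by (auto simp: sp_linear(2))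
next
  fix z
  assume "z \<in> lie_center (sp scale b)"
  then have z: "z \<in> sp scale b" and comm: "\<And>x. x \<in> sp scale b \<Longrightarrow> lie_bracket z x = (\<lambda>v. 0)"
    by (auto simp: lie_center_def)
  have eigen: "\<exists>c. z p = scale c p" if "p \<noteq> 0" for p
  proof -
    obtain x where x: "b x p = 1"
      using \<open>p \<noteq> 0\<close> by (rule nonzero_pairing)
    \<comment> \<open>\<open>conv 1 e p p\<close> is the rank one operator attached to
      \<open>p\<close>; as \<open>b x p = 1\<close>, the bracket at \<open>x\<close> isolates
      \<open>z p\<close>.\<close>
    have "lie_bracket z (conv 1 e p p) x = 0"
      using comm[OF conv_sp] by simp
    then have "z p = scale (b (z x) p) p"
      by (simp add: lie_bracket_def conv_def sp_linear[OF z] x)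
    then show ?thesis ..
  qed
  show "z \<in> range scale"
  proof (cases "\<exists>p::'v. p \<noteq> 0")
    case True
    then obtain p :: 'v where p: "p \<noteq> 0" by blast
    obtain c where c: "z p = scale c p"
      using eigen[OF p] by blast
    have "z v = scale c v" for v
    proof (cases "v = 0 \<or> p + v = 0")
      case True
      then have "v = 0 \<or> v = p"
        by (metis add_eq_0_iff vector_minus)
      then show ?thesis
        using c by (auto simp: sp_linear[OF z])
    next
      case False
      then obtain c' d where c': "z v = scale c' v" and d: "z (p + v) = scale d (p + v)"
        using eigen by metis
      have "scale c p + scale c' v = scale d p + scale d v"
        using d by (simp add: sp_linear[OF z] c c' scale_right_distrib)
      then have eq: "scale (c' - d) v = scale (d - c) p"
        by (simp add: scale_left_diff_distrib algebra_simps)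
      show ?thesis
      proof (cases "c' = d")
        case True
        then have "d = c"
          using eq p by simp
        then show ?thesis
          using c' True by simp
      next
        case False
        have "v = scale (1 / (c' - d)) (scale (c' - d) v)"
          using False by simp
        then have "v = scale ((d - c) / (c' - d)) p"
          unfolding eq by simp
        then show ?thesis
          by (metis c sp_linear(2)[OF z] scale_left_commute)
      qed
    qed
    then show ?thesis
      by auto
  next
    \<comment> \<open>The zero space remains, where every map is the zero scalar.\<close>
    case False
    then have "z = scale 0"
      by auto
    then show ?thesis
      by blast
  qed
qed

text \<open>A triangular change of generator. Adding a multiple of a higher \<open>ad\<close> power
  of the generator keeps the top of the chain, since everything beyond the identity is zero, and can
  be used to clear the other values of \<open>f\<close> one by one from the top down.\<close>

lemma dual_vector:
  assumes f_add: "\<And>x y. f (\<lambda>v. x v + y v) = f x + (f y :: 'k)"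
    and f_smult: "\<And>c x. f (\<lambda>v. scale c (x v)) = c * f x"
    and q: "q > 0"
    and f_id: "f (\<lambda>v. v) = 1"
    and x: "x \<in> sp scale b" "(ad ^^ (q - 1)) x = (\<lambda>v. v)"
  obtains x' where "x' \<in> sp scale b" "(ad ^^ (q - 1)) x' = (\<lambda>v. v)"
    "\<And>i. f ((ad ^^ i) x') = (if i = q - 1 then 1 else 0)"
proof -
  have f_0: "f (\<lambda>v. 0) = 0"
    using f_smult[of 0] by simp
  have top: "(ad ^^ i) y = (\<lambda>v. 0)" if "(ad ^^ (q - 1)) y = (\<lambda>v. v)" "i \<ge> q" for i y
  proof -
    have "i = (i - q) + Suc (q - 1)"
      using that q by simp
    then have "(ad ^^ i) y = (ad ^^ (i - q)) (ad ((ad ^^ (q - 1)) y))"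
      by (metis funpow.simps(2) funpow_add o_apply)
    then show ?thesis
      by (simp only: that ad_id ad_pow_0)
  qed
  \<comment> \<open>After \<open>j\<close> rounds the values at positions \<open>q - 1 - j\<close>
    up to \<open>q - 2\<close> are zero; \<open>j = q - 1\<close> clears them all.\<close>
  have "\<exists>y\<in>sp scale b. (ad ^^ (q - 1)) y = (\<lambda>v. v) \<and>
      (\<forall>i<q - 1. q - 1 \<le> i + j \<longrightarrow> f ((ad ^^ i) y) = 0)" if "j \<le> q - 1" for j
    using that
  proof (induction j)
    case 0
    then show ?case
      using x by auto
  next
    case (Suc j)
    then obtain y where y: "y \<in> sp scale b" "(ad ^^ (q - 1)) y = (\<lambda>v. v)"
      and fy: "\<And>i. i < q - 1 \<Longrightarrow> q - 1 \<le> i + j \<Longrightarrow> f ((ad ^^ i) y) = 0"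
      by auto
    \<comment> \<open>At position \<open>q - 1 - Suc j\<close> the correction contributes
      \<open>c\<close> times the value of \<open>f\<close> at the identity, that is
      \<open>c\<close>, and this cancels the old value in characteristic two.\<close>
    define c where "c = f ((ad ^^ (q - 1 - Suc j)) y)"
    define y' where "y' = (\<lambda>v. y v + scale c ((ad ^^ Suc j) y v))"
    have pow: "(ad ^^ i) y' = (\<lambda>v. (ad ^^ i) y v + scale c ((ad ^^ (i + Suc j)) y v))" for i
      unfolding y'_def ad_pow_add ad_pow_smult by (simp only: funpow_add o_apply)
    have "y' \<in> sp scale b"
      unfolding y'_def by (intro sp_add sp_smult ad_pow_sp y)
    moreover have "(ad ^^ (q - 1)) y' = (\<lambda>v. v)"
      unfolding pow y(2) using q by (subst top[OF y(2)]) auto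
    moreover have "f ((ad ^^ i) y') = 0" if i: "i < q - 1" "q - 1 \<le> i + Suc j" for i
    proof (cases "q - 1 = i + Suc j")
      case True
      then have "i = q - 1 - Suc j"
        by simp
      then show ?thesis
        unfolding pow f_add f_smult True[symmetric] y(2) f_id by (simp add: c_def)
    next
      case False
      then have "i + Suc j \<ge> q" "q - 1 \<le> i + j"
        using i by auto
      then show ?thesis
        unfolding pow f_add f_smult top[OF y(2) \<open>i + Suc j \<ge> q\<close>] using fy i by (simp add: f_0)
    qed
    ultimately show ?case
      by blast
  qed
  from this[OF order.refl] obtain y where y: "y \<in> sp scale b" "(ad ^^ (q - 1)) y = (\<lambda>v. v)"
      and fy: "\<And>i. i < q - 1 \<Longrightarrow> f ((ad ^^ i) y) = 0"
    by auto
  have "f ((ad ^^ i) y) = (if i = q - 1 then 1 else 0)" for i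
  proof (cases "i < q")
    case True
    then consider "i < q - 1" | "i = q - 1"
      by linarith
    then show ?thesis
      by cases (simp_all add: fy y(2) f_id del: One_nat_def)
  next
    case False
    then show ?thesis
      using top[OF y(2)] q by (simp add: f_0)
  qed
  then show ?thesis
    using that y by blast
qed

end

section \<open>Splitting off a Jordan block\<close>

text \<open>\<open>f\<close> is a functional on $\mathfrak{sp}(V)$ dual to the chain
  $x, \mathrm{ad}(e) x, \ldots, \mathrm{ad}(e)^{q-1} x = 1$.\<close>

locale dual_chain = char2_symplectic scale b e
  for scale :: "'k::field \<Rightarrow> 'v::ab_group_add \<Rightarrow> 'v" and b e +
  fixes f :: "('v \<Rightarrow> 'v) \<Rightarrow> 'k" and q :: nat and x :: "'v \<Rightarrow> 'v"
  assumes f_add: "f (\<lambda>v. y v + y' v) = f y + f y'"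
    and f_smult: "f (\<lambda>v. scale c (y v)) = c * f y"
    and f_ad: "y \<in> sp scale b \<Longrightarrow> f ((lie_bracket e ^^ q) y) = 0"
    and q: "q > 0"
    and x_sp: "x \<in> sp scale b"
    and ad_x: "(lie_bracket e ^^ (q - 1)) x = (\<lambda>v. v)"
    and f_x: "f ((lie_bracket e ^^ i) x) = (if i = q - 1 then 1 else 0)"
begin

text \<open>The order is reversed so that index 0 belongs to the identity, which \<open>ad\<close>
  kills. With this order \<open>ad\<close> becomes the left shift used in
  \<open>W_module\<close>.\<close>

definition comb :: "(nat \<Rightarrow> 'k) \<Rightarrow> 'v \<Rightarrow> 'v" where
  "comb c = (\<lambda>v. \<Sum>i<q. scale (c i) ((ad ^^ (q - 1 - i)) x v))"

definition coords :: "('v \<Rightarrow> 'v) \<Rightarrow> nat \<Rightarrow> 'k" where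
  "coords y = (\<lambda>i. f ((ad ^^ i) y))"

text \<open>The projection along the Jordan block; the plus sign is a difference in characteristic
  two.\<close>

definition rest :: "('v \<Rightarrow> 'v) \<Rightarrow> 'v \<Rightarrow> 'v" where
  "rest y = (\<lambda>v. y v + comb (coords y) v)"

text \<open>The largest \<open>ad\<close>-stable subspace of \<open>sp scale b\<close> on which
  \<open>f\<close> vanishes.\<close>

definition complement :: "('k, 'v \<Rightarrow> 'v) op_module" where
  "complement = (sp_module scale b e)\<lparr>carrier := {y \<in> sp scale b. coords y = (\<lambda>i. 0)}\<rparr>"

lemma f_0: "f (\<lambda>v. 0) = 0"
  using f_smult[of 0] by simp

lemma f_id: "f (\<lambda>v. v) = 1"
  using f_x[of "q - 1"] unfolding ad_x by simp

lemma f_sum: "f (\<lambda>v. \<Sum>i<n. scale (c i) (y i v)) = (\<Sum>i<n. c i * f (y i))" for n :: nat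
  by (induction n) (simp_all add: f_0 f_add f_smult)

lemma comb_sp: "comb c \<in> sp scale b"
  unfolding comb_def by (intro sp_lincomb ad_pow_sp x_sp)

lemma comb_add: "comb (\<lambda>i. c i + d i) = (\<lambda>v. comb c v + comb d v)"
  by (simp add: comb_def scale_left_distrib sum.distrib)

lemma comb_smult: "comb (\<lambda>i. c * d i) = (\<lambda>v. scale c (comb d v))"
  by (simp add: comb_def scale_sum_right)

lemma comb_0: "comb (\<lambda>i. 0) = (\<lambda>v. 0)"
  by (simp add: comb_def)

lemma comb_only_0:
  assumes "\<And>i. c (Suc i) = 0"
  shows "comb c = (\<lambda>v. scale (c 0) v)"
proof -
  obtain q' where q': "q = Suc q'"
    using q by (cases q) auto
  show ?thesis
    using ad_x assms unfolding comb_def unfolding q' sum.lessThan_Suc_shift by simp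
qed

text \<open>The term of index 0 is a multiple of the identity and dies; the others move down by one.
  The shifted sequence has \<open>c q\<close> at its last index, to which nothing on the left
  corresponds, whence the assumption.\<close>

lemma ad_comb:
  assumes "c q = 0"
  shows "ad (comb c) = comb (\<lambda>i. c (Suc i))"
proof
  fix v
  obtain q' where q': "q = Suc q'"
    using q by (cases q) auto
  have "ad (comb c) v = (\<Sum>i<q. scale (c i) (ad ((ad ^^ (q - 1 - i)) x) v))"
    using ad_pow_lincomb[of 1 c "\<lambda>i. (ad ^^ (q - 1 - i)) x"] by (simp add: comb_def)
  also have "\<dots> = scale (c 0) (ad ((ad ^^ (q - 1)) x) v) +
      (\<Sum>i<q'. scale (c (Suc i)) (ad ((ad ^^ (q' - Suc i)) x) v))"
    unfolding q' sum.lessThan_Suc_shift by simp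
  also have "\<dots> = (\<Sum>i<q'. scale (c (Suc i)) ((ad ^^ Suc (q' - Suc i)) x v))"
    unfolding ad_x ad_id by simp
  also have "\<dots> = (\<Sum>i<q'. scale (c (Suc i)) ((ad ^^ (q' - i)) x v))"
    by (intro sum.cong refl) (simp only: Suc_diff_Suc lessThan_iff)
  also have "\<dots> = comb (\<lambda>i. c (Suc i)) v"
    using assms unfolding comb_def unfolding q' by simp
  finally show "ad (comb c) v = comb (\<lambda>i. c (Suc i)) v" .
qed

lemma coords_add: "coords (\<lambda>v. y v + y' v) = (\<lambda>i. coords y i + coords y' i)"
  by (simp add: coords_def ad_pow_add f_add)

lemma coords_smult: "coords (\<lambda>v. scale c (y v)) = (\<lambda>i. c * coords y i)"
  by (simp add: coords_def ad_pow_smult f_smult)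

lemma coords_0: "coords (\<lambda>v. 0) = (\<lambda>i. 0)"
  by (simp add: coords_def ad_pow_0 f_0)

lemma coords_ad: "coords (ad y) = (\<lambda>i. coords y (Suc i))"
  by (simp add: coords_def funpow_swap1)

lemma coords_top:
  assumes "y \<in> sp scale b" "i \<ge> q"
  shows "coords y i = 0"
proof -
  have "(ad ^^ i) y = (ad ^^ q) ((ad ^^ (i - q)) y)"
    using assms(2) by (simp flip: funpow_add[THEN fun_cong, unfolded o_apply])
  then show ?thesis
    unfolding coords_def using f_ad ad_pow_sp assms(1) by simp
qed

text \<open>By \<open>f_x\<close> only the term with \<open>j + (q - 1 - i) = q - 1\<close>
  survives, that is \<open>i = j\<close>.\<close>

lemma coords_comb: "coords (comb c) = (\<lambda>j. if j < q then c j else 0)"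
proof
  fix j
  have "coords (comb c) j = (\<Sum>i<q. c i * f ((ad ^^ (j + (q - 1 - i))) x))"
    unfolding coords_def comb_def ad_pow_lincomb f_sum by (simp only: funpow_add o_apply)
  also have "\<dots> = (\<Sum>i<q. if i = j then c j else 0)"
    unfolding f_x by (intro sum.cong) auto
  finally show "coords (comb c) j = (if j < q then c j else 0)"
    by simp
qed

lemma coords_id: "coords (\<lambda>v. v) = (\<lambda>i. if i = 0 then 1 else 0)"
proof
  fix i
  show "coords (\<lambda>v. v) i = (if i = 0 then 1 else 0)"
    by (cases i) (simp_all add: coords_def f_id funpow_Suc_right ad_id ad_pow_0 f_0 del: funpow.simps(2))
qed

lemma rest_add: "rest (\<lambda>v. y v + y' v) = (\<lambda>v. rest y v + rest y' v)"
  by (simp add: rest_def coords_add comb_add algebra_simps)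

lemma rest_smult: "rest (\<lambda>v. scale c (y v)) = (\<lambda>v. scale c (rest y v))"
  by (simp add: rest_def coords_smult comb_smult scale_right_distrib)

lemma rest_ad:
  assumes "y \<in> sp scale b"
  shows "rest (ad y) = ad (rest y)"
  using ad_comb[of "coords y"] coords_top[OF assms order.refl] ad_pow_add[of 1 y "comb (coords y)"]
  by (simp add: rest_def coords_ad)

lemma rest_comb: "(\<And>i. i \<ge> q \<Longrightarrow> c i = 0) \<Longrightarrow> rest (comb c) = (\<lambda>v. 0)"
proof -
  assume "\<And>i. i \<ge> q \<Longrightarrow> c i = 0"
  then have "coords (comb c) = c"
    by (force simp: coords_comb)
  then show ?thesis
    by (simp add: rest_def)
qed

lemma rest_id: "rest (\<lambda>v. v) = (\<lambda>v. 0)"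
  by (simp add: rest_def coords_id comb_only_0)

lemma rest_fix: "coords y = (\<lambda>i. 0) \<Longrightarrow> rest y = y"
  by (simp add: rest_def comb_0)

lemma rest_complement:
  assumes "y \<in> sp scale b"
  shows "rest y \<in> carrier complement"
proof -
  have "rest y \<in> sp scale b"
    unfolding rest_def by (intro sp_add comb_sp assms)
  moreover have "coords (rest y) i = 0" for i
    using coords_top[OF assms, of i] by (simp add: rest_def coords_add coords_comb)
  ultimately show ?thesis
    by (simp add: complement_def fun_eq_iff)
qed

lemma comb_plus_complement:
  assumes "\<And>i. i \<ge> q \<Longrightarrow> c i = 0" "y \<in> carrier complement"
  shows "coords (\<lambda>v. comb c v + y v) = c" "rest (\<lambda>v. comb c v + y v) = y"
    "(\<lambda>v. comb c v + y v) \<in> sp scale b"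
proof -
  have y: "coords y = (\<lambda>i. 0)" "y \<in> sp scale b"
    using assms by (simp_all add: complement_def)
  show "coords (\<lambda>v. comb c v + y v) = c"
    using assms(1) by (force simp: coords_add coords_comb y)
  show "rest (\<lambda>v. comb c v + y v) = y"
    by (simp add: rest_add rest_comb assms(1) rest_fix y)
  show "(\<lambda>v. comb c v + y v) \<in> sp scale b"
    by (intro sp_add comb_sp y)
qed

section \<open>The complement as a module and the two isomorphisms\<close>

lemma ke_module_complement: "ke_module e complement"
proof -
  have ops: "zero complement = (\<lambda>v. 0)" "add complement = (\<lambda>x y v. x v + y v)"
    "smult complement = (\<lambda>c x v. scale c (x v))" "act complement = ad"
    by (simp_all add: complement_def sp_module_def)
  have closed: "zero complement \<in> carrier complement"
    "\<And>x y. x \<in> carrier complement \<Longrightarrow> y \<in> carrier complement \<Longrightarrow> add complement x y \<in> carrier complement"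
    "\<And>c x. x \<in> carrier complement \<Longrightarrow> smult complement c x \<in> carrier complement"
    "\<And>x. x \<in> carrier complement \<Longrightarrow> act complement x \<in> carrier complement"
    by (simp_all add: complement_def sp_module_def sp_add sp_smult sp_zero ad_sp
        coords_add coords_smult coords_ad coords_0)
  \<comment> \<open>Each element is its own negative.\<close>
  have neg: "\<exists>y\<in>carrier complement. add complement x y = zero complement"
    if "x \<in> carrier complement" for x
    using that by (intro bexI[of _ x]) (simp_all add: complement_def sp_module_def)
  have "op_module complement"
    unfolding op_module_def
  proof (intro conjI ballI allI closed neg)
    fix x y z c d
    show "add complement (add complement x y) z = add complement x (add complement y z)"
      by (simp add: ops add.assoc)
    show "add complement x y = add complement y x"
      by (simp add: ops add.commute)
    show "add complement (zero complement) x = x"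
      by (simp add: ops)
    show "smult complement c (add complement x y) = add complement (smult complement c x) (smult complement c y)"
      by (simp add: ops scale_right_distrib)
    show "smult complement (c + d) x = add complement (smult complement c x) (smult complement d x)"
      by (simp add: ops scale_left_distrib)
    show "smult complement (c * d) x = smult complement c (smult complement d x)"
      by (simp add: ops)
    show "smult complement 1 x = x"
      by (simp add: ops)
    show "act complement (add complement x y) = add complement (act complement x) (act complement y)"
      using ad_pow_add[of 1 x y] by (simp add: ops)
    show "act complement (smult complement c x) = smult complement c (act complement x)"
      using ad_pow_smult[of 1 c x] by (simp add: ops)
  qed
  moreover have "(act complement ^^ (2 ^ i)) y = zero complement"
    if "e ^^ (2 ^ i) = (\<lambda>v. 0)" "y \<in> carrier complement" for i y
    using that sp_linear(3)[of y] by (simp add: complement_def sp_module_def ad_pow2)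
  ultimately show ?thesis
    by (simp add: ke_module_def)
qed

lemma module_iso_sp: "module_iso (sp_module scale b e) (direct_sum (W_module q) complement)"
  unfolding module_iso_def
proof (intro exI[of _ "\<lambda>y. (coords y, rest y)"] conjI allI ballI)
  show "bij_betw (\<lambda>y. (coords y, rest y)) (carrier (sp_module scale b e))
      (carrier (direct_sum (W_module q) complement))"
  proof (rule bij_betw_byWitness[where f' = "\<lambda>p v. comb (fst p) v + snd p v"])
    show "\<forall>y\<in>carrier (sp_module scale b e). (\<lambda>v. comb (fst (coords y, rest y)) v + snd (coords y, rest y) v) = y"
      by (simp add: rest_def add.left_commute[of "comb _ _"])
    show "\<forall>p\<in>carrier (direct_sum (W_module q) complement).
        (coords (\<lambda>v. comb (fst p) v + snd p v), rest (\<lambda>v. comb (fst p) v + snd p v)) = p"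
      by (auto simp: direct_sum_def W_module_def comb_plus_complement)
    show "(\<lambda>y. (coords y, rest y)) ` carrier (sp_module scale b e)
        \<subseteq> carrier (direct_sum (W_module q) complement)"
      using rest_complement coords_top by (auto simp: direct_sum_def W_module_def sp_module_def)
    show "(\<lambda>p v. comb (fst p) v + snd p v) ` carrier (direct_sum (W_module q) complement)
        \<subseteq> carrier (sp_module scale b e)"
      by (auto simp: direct_sum_def sp_module_def W_module_def comb_plus_complement)
  qed
qed (auto simp: sp_module_def direct_sum_def W_module_def complement_def coords_add rest_add coords_smult
    rest_smult coords_ad rest_ad)

text \<open>Verifies \<open>fibre\<close> for the map that forgets coordinate 0. An element with
  zero \<open>rest\<close> and no other coordinate is a multiple of the identity, so two elements
  have the same image exactly when they differ by a scalar.\<close>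

lemma coset_center:
  assumes y: "y \<in> sp scale b"
  shows "coset (sp_module scale b e) (lie_center (sp scale b)) y =
    {y' \<in> sp scale b. (\<lambda>i. coords y' (Suc i)) = (\<lambda>i. coords y (Suc i)) \<and> rest y' = rest y}"
    (is "?L = ?R")
proof (intro equalityI subsetI)
  fix y'
  assume "y' \<in> ?L"
  then obtain c where "y' = (\<lambda>v. y v + scale c v)"
    by (auto simp: coset_def center_sp sp_module_def)
  then show "y' \<in> ?R"
    using y sp_scalar by (simp add: sp_add coords_add rest_add coords_smult rest_smult coords_id rest_id)
next
  fix y'
  assume y': "y' \<in> ?R"
  define d where "d = (\<lambda>v. y v + y' v)"
  have "coords y' (Suc i) = coords y (Suc i)" for i
    using y' by (auto dest: fun_cong)
  then have "coords d (Suc i) = 0" for i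
    by (simp add: d_def coords_add)
  moreover have "rest d = (\<lambda>v. 0)"
    using y' by (simp add: d_def rest_add)
  ultimately have "(\<lambda>v. d v + scale (coords d 0) v) = (\<lambda>v. 0)"
    using comb_only_0[of "coords d"] by (simp add: rest_def)
  then have "d v + scale (coords d 0) v = 0" for v
    by (rule fun_cong)
  then have d: "d v = scale (coords d 0) v" for v
    by (metis add_eq_0_iff vector_minus)
  have "y' v = y v + d v" for v
    by (simp add: d_def add.assoc[symmetric])
  then have "y' = (\<lambda>v. y v + scale (coords d 0) v)"
    using d by (metis ext)
  then show "y' \<in> ?L"
    by (auto simp: coset_def center_sp sp_module_def)
qed

lemma module_iso_quotient:
  "module_iso (quotient_module (sp_module scale b e) (lie_center (sp scale b)))
    (direct_sum (W_module (q - 1)) complement)"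
proof (rule quotient_module_iso[where \<phi> = "\<lambda>y. (\<lambda>i. coords y (Suc i), rest y)"])
  show "(\<lambda>y. (\<lambda>i. coords y (Suc i), rest y)) ` carrier (sp_module scale b e) =
      carrier (direct_sum (W_module (q - 1)) complement)"
  proof (intro equalityI subsetI)
    fix p
    assume p: "p \<in> carrier (direct_sum (W_module (q - 1)) complement)"
    \<comment> \<open>The forgotten coordinate is filled with 0 to obtain a preimage.\<close>
    define c where "c i = (case i of 0 \<Rightarrow> 0 | Suc j \<Rightarrow> fst p j)" for i
    have c: "c i = 0" if "i \<ge> q" for i
      using that p q by (cases i) (auto simp: c_def direct_sum_def W_module_def)
    have c_Suc: "(\<lambda>i. c (Suc i)) = fst p"
      by (simp add: c_def)
    have "snd p \<in> carrier complement"
      using p by (auto simp: direct_sum_def)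
    note * = comb_plus_complement[OF c this]
    show "p \<in> (\<lambda>y. (\<lambda>i. coords y (Suc i), rest y)) ` carrier (sp_module scale b e)"
      by (rule image_eqI[where x = "\<lambda>v. comb c v + snd p v"]) (simp_all add: * c_Suc sp_module_def)
  qed (use rest_complement coords_top in \<open>auto simp: direct_sum_def W_module_def sp_module_def\<close>)
next
  fix y
  assume "y \<in> carrier (sp_module scale b e)"
  then have "y \<in> sp scale b"
    by (simp add: sp_module_def)
  then show "coset (sp_module scale b e) (lie_center (sp scale b)) y =
      {y' \<in> carrier (sp_module scale b e). (\<lambda>i. coords y' (Suc i), rest y') = (\<lambda>i. coords y (Suc i), rest y)}"
    by (simp add: coset_center) (simp add: sp_module_def)
next
  fix y c
  assume "y \<in> carrier (sp_module scale b e)"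
  then have y: "y \<in> sp scale b"
    by (simp add: sp_module_def)
  show "smult (sp_module scale b e) c y \<in> carrier (sp_module scale b e)"
    using y by (simp add: sp_module_def sp_smult)
  show "act (sp_module scale b e) y \<in> carrier (sp_module scale b e)"
    using y by (simp add: sp_module_def ad_sp)
  show "(\<lambda>i. coords (smult (sp_module scale b e) c y) (Suc i), rest (smult (sp_module scale b e) c y)) =
      smult (direct_sum (W_module (q - 1)) complement) c (\<lambda>i. coords y (Suc i), rest y)"
    by (simp add: sp_module_def direct_sum_def W_module_def complement_def coords_smult rest_smult)
  show "(\<lambda>i. coords (act (sp_module scale b e) y) (Suc i), rest (act (sp_module scale b e) y)) =
      act (direct_sum (W_module (q - 1)) complement) (\<lambda>i. coords y (Suc i), rest y)"
    using y by (simp add: sp_module_def direct_sum_def W_module_def complement_def coords_ad rest_ad)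
  fix y'
  assume "y' \<in> carrier (sp_module scale b e)"
  then have y': "y' \<in> sp scale b"
    by (simp add: sp_module_def)
  show "add (sp_module scale b e) y y' \<in> carrier (sp_module scale b e)"
    using y y' by (simp add: sp_module_def sp_add)
  show "(\<lambda>i. coords (add (sp_module scale b e) y y') (Suc i), rest (add (sp_module scale b e) y y')) =
      add (direct_sum (W_module (q - 1)) complement) (\<lambda>i. coords y (Suc i), rest y) (\<lambda>i. coords y' (Suc i), rest y')"
    by (simp add: sp_module_def direct_sum_def W_module_def complement_def coords_add rest_add)
qed

end

section \<open>The blocks of the decomposition\<close>

text \<open>The size of the Jordan blocks of \<open>e\<close> on the summand: one of size 2d on
  V(2d), two of size m on W(m) and on W_k(m). These are the numbers whose common power of two is
  sought.\<close>

fun block_size :: "block \<Rightarrow> nat" where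
  "block_size (BW m) = m"
| "block_size (BWk k m) = m"
| "block_size (BV m) = 2 * m"

context char2_symplectic
begin

section \<open>Generators of the blocks and the form on their chains\<close>

lemma conv_eq_0: "(\<And>a. a < s \<Longrightarrow> b x ((e ^^ a) p) = 0) \<Longrightarrow> conv s e p r x = 0"
  by (simp add: conv_def)

lemma conv_single:
  assumes "j < s" "\<And>a. a < s \<Longrightarrow> b x ((e ^^ a) p) = (if a = j then 1 else 0)"
  shows "conv s e p r x = (e ^^ (s - 1 - j)) r"
proof -
  have "conv s e p r x = (\<Sum>a<s. if a = j then (e ^^ (s - 1 - j)) r else 0)"
    unfolding conv_def by (intro sum.cong) (auto simp: assms(2))
  also have "\<dots> = (e ^^ (s - 1 - j)) r"
    using assms(1) by simp
  finally show ?thesis .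
qed

lemma block_V_generator:
  assumes "isometric_to_block scale b e U (BV d)"
  obtains v where "0 < d" "\<And>a. (e ^^ a) v \<in> U" "U = span ((\<lambda>a. (e ^^ a) v) ` {..<2 * d})"
    "(e ^^ (2 * d)) v = 0" "\<And>a. b v ((e ^^ a) v) = (if Suc a = 2 * d then 1 else 0)"
proof -
  obtain v where d: "0 < d" and U: "U = span (v ` {1..2 * d})"
    and bv: "\<And>i j. i \<in> {1..2 * d} \<Longrightarrow> j \<in> {1..2 * d} \<Longrightarrow>
      b (v i) (v j) = (if i + j = 2 * d + 1 then 1 else 0)"
    and ev: "\<And>i. i \<in> {1..2 * d} \<Longrightarrow> e (v i) = (if i = 1 then 0 else v (i - 1))"
    using assms unfolding isometric_to_block_def by auto
  have pow: "(e ^^ a) (v (2 * d)) = v (2 * d - a)" if "a < 2 * d" for a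
    using that by (induction a) (auto simp: ev)
  have "(e ^^ Suc (2 * d - 1)) (v (2 * d)) = 0"
    unfolding funpow.simps o_apply using d by (simp add: pow ev)
  moreover have "Suc (2 * d - 1) = 2 * d"
    using d by simp
  ultimately have top: "(e ^^ (2 * d)) (v (2 * d)) = 0"
    by (simp only:)
  have "v ` {1..2 * d} = (\<lambda>a. (e ^^ a) (v (2 * d))) ` {..<2 * d}"
  proof (intro equalityI subsetI)
    fix x
    assume "x \<in> v ` {1..2 * d}"
    then obtain i where i: "i \<in> {1..2 * d}" "x = v i"
      by auto
    then show "x \<in> (\<lambda>a. (e ^^ a) (v (2 * d))) ` {..<2 * d}"
      using pow[of "2 * d - i"] by (intro image_eqI[of _ _ "2 * d - i"]) auto
  qed (auto simp: pow)
  then have span: "U = span ((\<lambda>a. (e ^^ a) (v (2 * d))) ` {..<2 * d})"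
    using U by simp
  have mem: "(e ^^ a) (v (2 * d)) \<in> U" for a
  proof (cases "a < 2 * d")
    case True
    then show ?thesis
      unfolding span by (intro span_base) auto
  next
    case False
    then show ?thesis
      using e_pow_zero[OF top, of a] by (simp add: span span_zero)
  qed
  have "b (v (2 * d)) ((e ^^ a) (v (2 * d))) = (if Suc a = 2 * d then 1 else 0)" for a
  proof (cases "a < 2 * d")
    case True
    then show ?thesis
      using d by (auto simp: pow bv)
  next
    case False
    then show ?thesis
      using e_pow_zero[OF top, of a] by (simp add: b_right)
  qed
  then show ?thesis
    using that[OF d mem span top] by blast
qed

text \<open>W(m) is treated as the case \<open>k = 0\<close> of W_k(m): the last formula then gives
  0 throughout. The generators are the basis vectors \<open>v m\<close> and
  \<open>v (2 * m)\<close>.\<close>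

lemma block_W_generators:
  assumes "isometric_to_block scale b e U B" "B = BW m \<or> (\<exists>k. B = BWk k m)"
  obtains u w k where "2 * k < m" "\<And>a. (e ^^ a) u \<in> U" "\<And>a. (e ^^ a) w \<in> U"
    "U \<subseteq> span ((\<lambda>a. (e ^^ a) u) ` {..<m} \<union> (\<lambda>a. (e ^^ a) w) ` {..<m})"
    "(e ^^ m) u = 0" "(e ^^ m) w = 0" "\<And>a. b u ((e ^^ a) u) = 0"
    "\<And>a. b u ((e ^^ a) w) = (if Suc a = m then 1 else 0)"
    "\<And>a. b w ((e ^^ a) w) = (if Suc a = 2 * k then 1 else 0)"
proof -
  obtain v k where k: "2 * k < m" and U: "U = span (v ` {1..2 * m})"
    and bv: "\<And>i j. i \<in> {1..2 * m} \<Longrightarrow> j \<in> {1..2 * m} \<Longrightarrow>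
      b (v i) (v j) = (if i + j = 2 * m + 1 then 1 else 0)"
    and ev: "\<And>i. i \<in> {1..2 * m} \<Longrightarrow> e (v i) = (if i = 1 \<or> i = m + 1 then 0
      else if 0 < k \<and> i = 2 * m - k + 1 then v (2 * m - k) + v k else v (i - 1))"
    using assms(2)
  proof (elim disjE exE)
    assume B: "B = BW m"
    then obtain v where "0 < m" "U = span (v ` {1..2 * m})"
      "\<forall>i\<in>{1..2 * m}. \<forall>j\<in>{1..2 * m}. b (v i) (v j) = (if i + j = 2 * m + 1 then 1 else 0)"
      "\<forall>i\<in>{1..2 * m}. e (v i) = (if i = 1 \<or> i = m + 1 then 0 else v (i - 1))"
      using assms(1) by (auto simp: isometric_to_block_def)
    then show ?thesis
      by (intro that[of 0 v]) auto
  next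
    fix k
    assume B: "B = BWk k m"
    then obtain v where "0 < k" "2 * k < m" "U = span (v ` {1..2 * m})"
      "\<forall>i\<in>{1..2 * m}. \<forall>j\<in>{1..2 * m}. b (v i) (v j) = (if i + j = 2 * m + 1 then 1 else 0)"
      "\<forall>i\<in>{1..2 * m}. e (v i) = (if i = 1 \<or> i = m + 1 then 0
        else if i = 2 * m - k + 1 then v (2 * m - k) + v k else v (i - 1))"
      using assms(1) by (auto simp: isometric_to_block_def)
    then show ?thesis
      by (intro that[of k v]) auto
  qed
  define u where "u = v m"
  define w where "w = v (2 * m)"
  have m: "0 < m" and Suc_m: "Suc (m - 1) = m"
    using k by simp_all
  have pow_u: "(e ^^ a) u = v (m - a)" if "a < m" for a
    using that
  proof (induction a)
    case (Suc a)
    then have "m - a \<in> {1..2 * m}" "m - a \<noteq> 1" "m - a \<noteq> m + 1" "m - a \<noteq> 2 * m - k + 1"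
      using k by auto
    then show ?case
      using Suc ev[of "m - a"] by simp
  qed (simp add: u_def)
  \<comment> \<open>The k-th application of \<open>e\<close> picks up the extra summand
    \<open>v k\<close>, which then descends to \<open>v 1\<close> at \<open>a = 2 * k - 1\<close>
    and disappears.\<close>
  have pow_w: "(e ^^ a) w = v (2 * m - a) + (if k \<le> a \<and> a < 2 * k then v (2 * k - a) else 0)"
    if "a < m" for a
    using that
  proof (induction a)
    case (Suc a)
    then have *: "2 * m - a \<in> {1..2 * m}" "2 * m - a \<noteq> 1" "2 * m - a \<noteq> m + 1"
      "0 < k \<and> 2 * m - a = 2 * m - k + 1 \<longleftrightarrow> Suc a = k"
      using k by auto
    have "e (v (2 * m - a)) = v (2 * m - Suc a) + (if Suc a = k then v k else 0)"
      using ev[OF *(1)] * k by auto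
    moreover have "e (if k \<le> a \<and> a < 2 * k then v (2 * k - a) else 0) =
        (if k \<le> a \<and> Suc a < 2 * k then v (2 * k - Suc a) else 0)"
    proof (cases "k \<le> a \<and> a < 2 * k")
      case True
      then have "2 * k - a \<in> {1..2 * m}" "2 * k - a \<le> k" "2 * k - a = 1 \<longleftrightarrow> \<not> Suc a < 2 * k"
        using k by auto
      then show ?thesis
        using ev[of "2 * k - a"] True k by auto
    qed (auto simp: e_linear)
    ultimately show ?case
      using Suc k by (auto simp: e_linear)
  qed (use k in \<open>auto simp: w_def\<close>)
  have "(e ^^ Suc (m - 1)) u = 0"
    unfolding funpow.simps o_apply using m by (simp add: pow_u ev)
  then have top_u: "(e ^^ m) u = 0"
    by (simp only: Suc_m)
  have "(e ^^ Suc (m - 1)) w = 0"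
  proof -
    \<comment> \<open>Because \<open>2 * k < m\<close>, the extra summand has died before the main
      chain ends.\<close>
    have "\<not> (k \<le> m - 1 \<and> m - 1 < 2 * k)" "2 * m - (m - 1) = m + 1"
      using k by auto
    then have "(e ^^ (m - 1)) w = v (m + 1)"
      using pow_w[of "m - 1"] m by (simp only: if_False add_0_right diff_less zero_less_one)
    then show ?thesis
      unfolding funpow.simps o_apply using ev[of "m + 1"] m by simp
  qed
  then have top_w: "(e ^^ m) w = 0"
    by (simp only: Suc_m)
  have vU: "v i \<in> U" if "i \<in> {1..2 * m}" for i
    unfolding U using that by (intro span_base) auto
  have mem_u: "(e ^^ a) u \<in> U" for a
  proof (cases "a < m")
    case True
    then show ?thesis
      by (auto simp: pow_u intro!: vU)
  next
    case False
    then show ?thesis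
      using e_pow_zero[OF top_u, of a] by (simp add: U span_zero)
  qed
  have mem_w: "(e ^^ a) w \<in> U" for a
  proof (cases "a < m")
    case True
    then have "v (2 * m - a) \<in> U" "k \<le> a \<and> a < 2 * k \<Longrightarrow> v (2 * k - a) \<in> U" "0 \<in> U"
      using k by (auto intro!: vU) (simp add: U span_zero)
    then show ?thesis
      using True unfolding U by (auto simp: pow_w intro!: span_add)
  next
    case False
    then show ?thesis
      using e_pow_zero[OF top_w, of a] by (simp add: U span_zero)
  qed
  have buu: "b u ((e ^^ a) u) = 0" for a
  proof (cases "a < m")
    case True
    then have "b u (v (m - a)) = 0"
      unfolding u_def by (subst bv) auto
    then show ?thesis
      using True by (simp add: pow_u)
  next
    case False
    then show ?thesis
      using e_pow_zero[OF top_u, of a] by (simp add: b_right)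
  qed
  have buw: "b u ((e ^^ a) w) = (if Suc a = m then 1 else 0)" for a
  proof (cases "a < m")
    case True
    then have "b u (v (2 * m - a)) = (if Suc a = m then 1 else 0)"
      unfolding u_def by (subst bv) auto
    moreover have "b u (v (2 * k - a)) = 0" if "k \<le> a \<and> a < 2 * k"
      using that k unfolding u_def by (subst bv) auto
    ultimately show ?thesis
      using True by (simp add: pow_w b_right)
  next
    case False
    then show ?thesis
      using e_pow_zero[OF top_w, of a] by (simp add: b_right)
  qed
  have bww: "b w ((e ^^ a) w) = (if Suc a = 2 * k then 1 else 0)" for a
  proof (cases "a < m")
    case True
    then have "b w (v (2 * m - a)) = 0"
      unfolding w_def by (subst bv) auto
    moreover have "b w (v (2 * k - a)) = (if Suc a = 2 * k then 1 else 0)" if "k \<le> a \<and> a < 2 * k"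
      using that k unfolding w_def by (subst bv) auto
    ultimately show ?thesis
      using True k by (auto simp: pow_w b_right)
  next
    case False
    then show ?thesis
      using e_pow_zero[OF top_w, of a] k by (simp add: b_right)
  qed
  define G where "G = (\<lambda>a. (e ^^ a) u) ` {..<m} \<union> (\<lambda>a. (e ^^ a) w) ` {..<m}"
  have low: "v i \<in> span G" if "i \<in> {1..m}" for i
  proof -
    have "v i = (e ^^ (m - i)) u"
      using that by (subst pow_u) auto
    moreover have "m - i < m"
      using that by auto
    ultimately show ?thesis
      by (auto simp: G_def intro!: span_base)
  qed
  have "v i \<in> span G" if "i \<in> {1..2 * m}" for i
  proof (cases "i \<le> m")
    case False
    define a where "a = 2 * m - i"
    have a: "a < m" "i = 2 * m - a"
      using False that by (auto simp: a_def)
    have 1: "(e ^^ a) w \<in> span G"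
      using a by (auto simp: G_def intro!: span_base)
    have 2: "(if k \<le> a \<and> a < 2 * k then v (2 * k - a) else 0) \<in> span G"
      using k a by (auto intro!: low span_zero)
    have "v i = (e ^^ a) w - (if k \<le> a \<and> a < 2 * k then v (2 * k - a) else 0)"
      using a by (simp add: pow_w)
    then show ?thesis
      using span_diff[OF 1 2] by simp
  qed (use that low in auto)
  then have "U \<subseteq> span G"
    unfolding U by (intro span_minimal subspace_span) auto
  then show ?thesis
    using that[OF k mem_u mem_w _ top_u top_w buu buw bww] by (simp add: G_def)
qed

lemma fixes_span_of_chains:
  assumes F: "Vector_Spaces.linear scale scale F"
    and comm: "\<And>x. F (e x) = e (F x)"
    and gen: "\<And>p. p \<in> P \<Longrightarrow> F p = p"
    and x: "x \<in> span (\<Union>p\<in>P. (\<lambda>a. (e ^^ a) p) ` {..<n})"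
  shows "F x = x"
proof -
  have "subspace {x. F x = x}"
    using F by (auto simp: subspace_def linear_scale_iff dest: spec[of _ 0])
  moreover have "F ((e ^^ a) p) = (e ^^ a) p" if "p \<in> P" for a p
    by (induction a) (simp_all add: comm gen that)
  ultimately have "span (\<Union>p\<in>P. (\<lambda>a. (e ^^ a) p) ` {..<n}) \<subseteq> {x. F x = x}"
    by (intro span_minimal) auto
  then show ?thesis
    using x by auto
qed

text \<open>On $W_k(m)$ the form $b(w, e^{2k-1} w) = 1$ perturbs the naive identity; the term with
  \<open>u' = e\<^bsup>m/2-k\<^esup> u\<close> corrects this.\<close>

lemma block_identity:
  assumes iso: "isometric_to_block scale b e U B" and q: "2 ^ n dvd block_size B" "0 < n"
  obtains y where "y \<in> sp scale b" "\<And>x. x \<in> U \<Longrightarrow> (ad ^^ (2 ^ n - 1)) y x = x"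
    "\<And>x. (\<And>v. v \<in> U \<Longrightarrow> b x v = 0) \<Longrightarrow> (ad ^^ (2 ^ n - 1)) y x = 0"
proof -
  obtain r where r: "block_size B = r * 2 ^ n"
    using q(1) by (auto simp: dvd_def mult.commute)
  let ?g = "e ^^ (2 ^ n)"
  consider d where "B = BV d" | m where "B = BW m \<or> (\<exists>k. B = BWk k m)"
    by (cases B) auto
  then show ?thesis
  proof cases
    case (1 d)
    obtain v where d: "0 < d" and U: "\<And>a. (e ^^ a) v \<in> U"
      "U = span ((\<lambda>a. (e ^^ a) v) ` {..<2 * d})"
      and top: "(e ^^ (2 * d)) v = 0"
      and bv: "\<And>a. b v ((e ^^ a) v) = (if Suc a = 2 * d then 1 else 0)"
      using block_V_generator iso 1 by metis
    have ad: "(ad ^^ (2 ^ n - 1)) (conv r ?g v v) = conv (2 * d) e v v"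
      using r 1 by (simp only: ad_pow_conv block_size.simps)
    show ?thesis
    proof (rule that[OF conv_sp[of r ?g v]])
      fix x
      assume "x \<in> U"
      have "conv (2 * d) e v v v = v"
        using d by (subst conv_single[of "2 * d - 1"]) (auto simp: bv)
      moreover have "x \<in> span (\<Union>p\<in>{v}. (\<lambda>a. (e ^^ a) p) ` {..<2 * d})"
        using \<open>x \<in> U\<close> U(2) by simp
      ultimately have "conv (2 * d) e v v x = x"
        using fixes_span_of_chains[OF conv_linear, of "2 * d" e v v "{v}" x "2 * d"]
        by (simp add: conv_commute top)
      then show "(ad ^^ (2 ^ n - 1)) (conv r ?g v v) x = x"
        by (simp only: ad)
    next
      fix x
      assume "\<And>v. v \<in> U \<Longrightarrow> b x v = 0"
      then show "(ad ^^ (2 ^ n - 1)) (conv r ?g v v) x = 0"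
        unfolding ad by (intro conv_eq_0) (simp add: U(1))
    qed
  next
    case (2 m)
    obtain u w k where k: "2 * k < m" and U: "\<And>a. (e ^^ a) u \<in> U" "\<And>a. (e ^^ a) w \<in> U"
      "U \<subseteq> span ((\<lambda>a. (e ^^ a) u) ` {..<m} \<union> (\<lambda>a. (e ^^ a) w) ` {..<m})"
      and top: "(e ^^ m) u = 0" "(e ^^ m) w = 0" and buu: "\<And>a. b u ((e ^^ a) u) = 0"
      and buw: "\<And>a. b u ((e ^^ a) w) = (if Suc a = m then 1 else 0)"
      and bww: "\<And>a. b w ((e ^^ a) w) = (if Suc a = 2 * k then 1 else 0)"
      using block_W_generators[OF iso 2] by metis
    have m: "m = r * 2 ^ n"
      using r 2 by auto
    \<comment> \<open>Here \<open>0 < n\<close> enters: half of \<open>m\<close> is needed for the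
      exponent \<open>c\<close> of the correction term.\<close>
    then have "even m"
      using q(2) by simp
    then obtain h where h: "m = 2 * h"
      by auto
    define c where "c = h - k"
    define u' where "u' = (e ^^ c) u"
    have top': "(e ^^ m) u' = 0"
      unfolding u'_def e_pow_pow by (rule e_pow_zero[OF top(1)]) simp
    have bwu: "b w ((e ^^ a) u) = (if Suc a = m then 1 else 0)" for a
      using buw[of a] by (simp add: e_pow_adjoint[symmetric] b_commute[of _ u])
    define y where "y = (\<lambda>x. (conv r ?g u w x + conv r ?g w u x) + conv r ?g u' u' x)"
    define F where "F = (\<lambda>x. (conv m e u w x + conv m e w u x) + conv m e u' u' x)"
    have ad: "(ad ^^ (2 ^ n - 1)) y = F"
      unfolding y_def F_def ad_pow_add ad_pow_conv m[symmetric] ..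
    have F_linear: "Vector_Spaces.linear scale scale F"
      using conv_linear[of m e u w] conv_linear[of m e w u] conv_linear[of m e u' u']
      unfolding F_def linear_scale_iff by (simp add: scale_right_distrib add_ac)
    have F_comm: "F (e x) = e (F x)" for x
      by (simp add: F_def e_linear conv_commute top top')
    have Fu: "F u = u"
    proof -
      have "conv m e u w u = 0" "conv m e u' u' u = 0"
        by (auto intro!: conv_eq_0 simp: buu u'_def e_pow_pow)
      moreover have "conv m e w u u = u"
        using k by (subst conv_single[of "m - 1"]) (auto simp: buw)
      ultimately show ?thesis
        by (simp add: F_def)
    qed
    have Fw: "F w = w"
    proof -
      have "conv m e u w w = w"
        using k by (subst conv_single[of "m - 1"]) (auto simp: bwu)
      \<comment> \<open>This is the perturbation; for \<open>k = 0\<close> it is the m-th power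
        applied to \<open>u\<close>, hence zero.\<close>
      moreover have "conv m e w u w = (e ^^ (m - 2 * k)) u"
      proof (cases "k = 0")
        case True
        then show ?thesis
          by (simp add: conv_eq_0 bww top)
      next
        case False
        then show ?thesis
          using k by (subst conv_single[of "2 * k - 1"]) (auto simp: bww)
      qed
      \<comment> \<open>Only \<open>a = m - 1 - c\<close> pairs nontrivially with \<open>w\<close>,
        leaving exponent \<open>2 * c = m - 2 * k\<close> on \<open>u\<close>. This equals the
        perturbation, so the two cancel.\<close>
      moreover have "conv m e u' u' w = (e ^^ (m - 2 * k)) u"
      proof -
        have "conv m e u' u' w = (e ^^ (m - 1 - (m - 1 - c))) u'"
          using k h by (intro conv_single) (auto simp: u'_def e_pow_pow bwu c_def)
        moreover have "m - 1 - (m - 1 - c) + c = m - 2 * k"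
          using k h by (auto simp: c_def)
        ultimately show ?thesis
          by (simp only: u'_def e_pow_pow)
      qed
      ultimately show ?thesis
        by (simp add: F_def add.assoc)
    qed
    have y: "y \<in> sp scale b"
      unfolding y_def by (intro sp_add[OF conv_sym_sp conv_sp])
    show ?thesis
    proof (rule that[OF y])
      fix x
      assume "x \<in> U"
      then have "x \<in> span (\<Union>p\<in>{u, w}. (\<lambda>a. (e ^^ a) p) ` {..<m})"
        using U(3) by auto
      then have "F x = x"
        using fixes_span_of_chains[OF F_linear F_comm, of "{u, w}" x m] Fu Fw by blast
      then show "(ad ^^ (2 ^ n - 1)) y x = x"
        by (simp only: ad)
    next
      fix x
      assume x: "\<And>v. v \<in> U \<Longrightarrow> b x v = 0"
      have "conv m e u w x = 0" "conv m e w u x = 0" "conv m e u' u' x = 0"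
        by (auto intro!: conv_eq_0 x U simp: u'_def e_pow_pow)
      then show "(ad ^^ (2 ^ n - 1)) y x = 0"
        unfolding ad by (simp add: F_def)
    qed
  qed
qed

text \<open>Supplies the test vectors for \<open>separating_functional\<close>. On V(2d) one
  generator is paired with itself; otherwise the two generators are paired with each other.\<close>

lemma block_top_pairing:
  assumes "isometric_to_block scale b e U B"
  obtains v w where "0 < block_size B" "(e ^^ block_size B) v = 0" "(e ^^ block_size B) w = 0"
    "b ((e ^^ (block_size B - 1)) v) w = 1"
proof -
  consider d where "B = BV d" | m where "B = BW m \<or> (\<exists>k. B = BWk k m)"
    by (cases B) auto
  then show ?thesis
  proof cases
    case (1 d)
    obtain v where "0 < d" "(e ^^ (2 * d)) v = 0"
      "\<And>a. b v ((e ^^ a) v) = (if Suc a = 2 * d then 1 else 0)"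
      using block_V_generator assms 1 by metis
    then show ?thesis
      using 1 by (intro that[of v v]) (auto simp: e_pow_adjoint)
  next
    case (2 m)
    obtain u w k where "2 * k < m" "(e ^^ m) u = 0" "(e ^^ m) w = 0"
      "\<And>a. b u ((e ^^ a) w) = (if Suc a = m then 1 else 0)"
      using block_W_generators[OF assms 2] by metis
    moreover have "block_size B = m"
      using 2 by auto
    ultimately show ?thesis
      by (intro that[of u w]) (auto simp: e_pow_adjoint)
  qed
qed

lemma orthogonal_decompositionE:
  assumes "orthogonal_decomposition scale b e Bs"
  obtains U where "\<And>i. i < length Bs \<Longrightarrow> isometric_to_block scale b e (U i) (Bs ! i)"
    "\<And>i j x y. i < length Bs \<Longrightarrow> j < length Bs \<Longrightarrow> i \<noteq> j \<Longrightarrow> x \<in> U i \<Longrightarrow> y \<in> U j \<Longrightarrow> b x y = 0"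
    "\<And>x. \<exists>u. (\<forall>i<length Bs. u i \<in> U i) \<and> x = (\<Sum>i<length Bs. u i)"
  using assms unfolding orthogonal_decomposition_def by metis

text \<open>Each block contributes a preimage of the orthogonal projection onto its subspace, and
  the projections add up to the identity.\<close>

lemma identity_in_image:
  assumes dec: "orthogonal_decomposition scale b e Bs"
    and q: "\<And>B. B \<in> set Bs \<Longrightarrow> 2 ^ n dvd block_size B"
  obtains y where "y \<in> sp scale b" "(ad ^^ (2 ^ n - 1)) y = (\<lambda>v. v)"
proof (cases "n = 0")
  \<comment> \<open>\<open>block_identity\<close> requires a positive exponent; for
    \<open>n = 0\<close> the identity is its own preimage.\<close>
  case True
  then show ?thesis
    using that[of "\<lambda>v. v"] sp_scalar[of 1] by simp
next
  case False
  obtain U where iso: "\<And>i. i < length Bs \<Longrightarrow> isometric_to_block scale b e (U i) (Bs ! i)"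
    and orth: "\<And>i j x y. i < length Bs \<Longrightarrow> j < length Bs \<Longrightarrow> i \<noteq> j \<Longrightarrow> x \<in> U i \<Longrightarrow> y \<in> U j \<Longrightarrow>
      b x y = 0"
    and sum: "\<And>x. \<exists>u. (\<forall>i<length Bs. u i \<in> U i) \<and> x = (\<Sum>i<length Bs. u i)"
    using orthogonal_decompositionE[OF dec] by metis
  have "\<exists>y\<in>sp scale b. (\<forall>x\<in>U i. (ad ^^ (2 ^ n - 1)) y x = x) \<and>
      (\<forall>x. (\<forall>v\<in>U i. b x v = 0) \<longrightarrow> (ad ^^ (2 ^ n - 1)) y x = 0)" if "i < length Bs" for i
    using block_identity[OF iso[OF that] q] that False by (metis bot_nat_0.not_eq_extremum nth_mem)
  then obtain y where y: "\<And>i. i < length Bs \<Longrightarrow> y i \<in> sp scale b"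
    and id_U: "\<And>i x. i < length Bs \<Longrightarrow> x \<in> U i \<Longrightarrow> (ad ^^ (2 ^ n - 1)) (y i) x = x"
    and van: "\<And>i x. i < length Bs \<Longrightarrow> (\<forall>v\<in>U i. b x v = 0) \<Longrightarrow> (ad ^^ (2 ^ n - 1)) (y i) x = 0"
    by metis
  show ?thesis
  proof (rule that[of "\<lambda>v. \<Sum>i<length Bs. scale 1 (y i v)"])
    show "(\<lambda>v. \<Sum>i<length Bs. scale 1 (y i v)) \<in> sp scale b"
      by (intro sp_lincomb y) simp
    show "(ad ^^ (2 ^ n - 1)) (\<lambda>v. \<Sum>i<length Bs. scale 1 (y i v)) = (\<lambda>v. v)"
    proof
      fix x
      obtain u where u: "\<And>i. i < length Bs \<Longrightarrow> u i \<in> U i" and x: "x = (\<Sum>i<length Bs. u i)"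
        using sum by metis
      have "(ad ^^ (2 ^ n - 1)) (y i) x = u i" if i: "i < length Bs" for i
      proof -
        have "(ad ^^ (2 ^ n - 1)) (y i) x = (\<Sum>j<length Bs. (ad ^^ (2 ^ n - 1)) (y i) (u j))"
          unfolding x by (rule sp_linear[OF ad_pow_sp[OF y[OF i]]])
        also have "\<dots> = (\<Sum>j<length Bs. if j = i then u i else 0)"
          using i u orth by (intro sum.cong) (auto simp: id_U simp del: One_nat_def intro!: van)
        finally show ?thesis
          using i by simp
      qed
      then show "(ad ^^ (2 ^ n - 1)) (\<lambda>v. \<Sum>i<length Bs. scale 1 (y i v)) x = x"
        unfolding ad_pow_lincomb by (simp add: x)
    qed
  qed
qed

text \<open>For \<open>r\<close> odd, $\sum_{a+c=r-1} u^a Z u^c$ is $u^{r-1}$ when \<open>Z = 1\<close>, and $[u^r, Y]$ when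
  \<open>Z = [u, Y]\<close>; here \<open>u = e\<^bsup>q\<^esup>\<close>.\<close>

lemma separating_functional:
  assumes iso: "isometric_to_block scale b e U B"
    and r: "block_size B = 2 ^ n * r" "odd r"
  obtains f where "\<And>x y. f (\<lambda>v. x v + y v) = f x + (f y :: 'k)"
    "\<And>c x. f (\<lambda>v. scale c (x v)) = c * f x"
    "\<And>y. y \<in> sp scale b \<Longrightarrow> f ((ad ^^ (2 ^ n)) y) = 0" "f (\<lambda>v. v) = 1"
proof -
  define q :: nat where "q = 2 ^ n"
  obtain v w where s: "0 < block_size B" and top: "(e ^^ (q * r)) v = 0" "(e ^^ (q * r)) w = 0"
    and vw: "b ((e ^^ (q * r - 1)) v) w = 1"
    using block_top_pairing[OF iso] r(1) by (metis q_def)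
  have r_pos: "0 < r" and q_pos: "0 < q"
    using r(2) by (auto simp: q_def odd_pos)
  define f where "f Z = b ((e ^^ (q - 1)) (\<Sum>a<r. (e ^^ (q * a)) (Z ((e ^^ (q * (r - 1 - a))) v)))) w" for Z
  show ?thesis
  proof (rule that[of f])
    show "f (\<lambda>v. x v + y v) = f x + f y" for x y
      by (simp add: f_def e_pow_linear b_left sum.distrib)
    show "f (\<lambda>v. scale c (x v)) = c * f x" for c x
      by (simp add: f_def e_pow_linear b_left sum_distrib_left)
  next
    fix Y
    assume Y: "Y \<in> sp scale b"
    define h where "h a = (e ^^ (q * a)) (Y ((e ^^ (q * (r - a))) v))" for a
    \<comment> \<open>Telescoping leaves \<open>h r - h 0\<close>. The term \<open>h 0\<close>
      vanishes because \<open>v\<close> is killed, and \<open>h r\<close> will vanish against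
      \<open>w\<close> once its power of \<open>e\<close> is moved across the form.\<close>
    have "(\<Sum>a<r. (e ^^ (q * a)) ((ad ^^ q) Y ((e ^^ (q * (r - 1 - a))) v))) = (\<Sum>a<r. h (Suc a) - h a)"
    proof (intro sum.cong refl)
      fix a
      assume "a \<in> {..<r}"
      then have "q + q * (r - 1 - a) = q * (r - a)"
        by (metis Suc_diff_Suc diff_Suc_eq_diff_pred lessThan_iff mult_Suc_right)
      then show "(e ^^ (q * a)) ((ad ^^ q) Y ((e ^^ (q * (r - 1 - a))) v)) = h (Suc a) - h a"
        unfolding q_def ad_pow2 unfolding q_def[symmetric] h_def vector_diff
        by (simp add: e_pow_linear e_pow_pow add.commute)
    qed
    also have "\<dots> = h r - h 0"
      by (rule sum_lessThan_telescope)
    also have "\<dots> = (e ^^ (q * r)) (Y v)"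
      by (simp add: h_def top sp_linear(3)[OF Y])
    finally have "f ((ad ^^ q) Y) = b ((e ^^ (q - 1)) ((e ^^ (q * r)) (Y v))) w"
      by (simp add: f_def)
    also have "\<dots> = b ((e ^^ (q - 1)) (Y v)) ((e ^^ (q * r)) w)"
      by (simp add: e_pow_pow add.commute flip: e_pow_adjoint)
    finally show "f ((ad ^^ 2 ^ n) Y) = 0"
      by (simp only: top b_right flip: q_def)
  next
    \<comment> \<open>At the identity all \<open>r\<close> terms coincide, and an odd number of
      equal terms sums to one of them.\<close>
    have "(\<Sum>a<r. (e ^^ (q * a)) ((e ^^ (q * (r - 1 - a))) v)) = (\<Sum>a<r. (e ^^ (q * (r - 1))) v)"
      by (intro sum.cong) (auto simp: e_pow_pow simp flip: add_mult_distrib2)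
    also have "\<dots> = scale (of_nat r) ((e ^^ (q * (r - 1))) v)"
      by (simp add: sum_constant_scale)
    also have "\<dots> = (e ^^ (q * (r - 1))) v"
      by (simp add: of_nat_odd r)
    finally have "f (\<lambda>v. v) = b ((e ^^ (q - 1 + q * (r - 1))) v) w"
      by (simp add: f_def e_pow_pow)
    also have "q - 1 + q * (r - 1) = q * r - 1"
      using r_pos q_pos by (cases r) auto
    finally show "f (\<lambda>v. v) = 1"
      using vw by simp
  qed
qed

text \<open>Divisibility of all sizes puts the identity in the image of the power of
  \<open>ad\<close> with exponent \<open>2 ^ n - 1\<close>. The block \<open>B\<close>, whose size
  is an odd multiple of \<open>2 ^ n\<close>, yields the functional that makes the chain split
  off.\<close>

theorem sp_module_splitting:
  assumes dec: "orthogonal_decomposition scale b e Bs"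
    and all: "\<And>B. B \<in> set Bs \<Longrightarrow> 2 ^ n dvd block_size B"
    and ex: "B \<in> set Bs" "\<not> 2 ^ Suc n dvd block_size B"
  shows "\<exists>V' :: ('k, 'v \<Rightarrow> 'v) op_module. ke_module e V' \<and>
    module_iso (sp_module scale b e) (direct_sum (W_module (2 ^ n)) V') \<and>
    module_iso (quotient_module (sp_module scale b e) (lie_center (sp scale b)))
      (direct_sum (W_module (2 ^ n - 1)) V')"
proof -
  obtain i where i: "i < length Bs" "B = Bs ! i"
    using ex(1) by (metis in_set_conv_nth)
  obtain U where iso: "isometric_to_block scale b e (U i) B"
    using orthogonal_decompositionE[OF dec] i by metis
  obtain r where r: "block_size B = 2 ^ n * r"
    using all[OF ex(1)] by auto
  then have "odd r"
    using ex(2) by (auto simp: mult.commute)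
  obtain f where f: "\<And>x y. f (\<lambda>v. x v + y v) = f x + (f y :: 'k)"
    "\<And>c x. f (\<lambda>v. scale c (x v)) = c * f x"
    "\<And>y. y \<in> sp scale b \<Longrightarrow> f ((ad ^^ (2 ^ n)) y) = 0" and f_id: "f (\<lambda>v. v) = 1"
    using separating_functional[OF iso r \<open>odd r\<close>] by blast
  obtain y where y: "y \<in> sp scale b" "(ad ^^ (2 ^ n - 1)) y = (\<lambda>v. v)"
    using identity_in_image[OF dec all] by blast
  obtain x where x: "x \<in> sp scale b" "(ad ^^ (2 ^ n - 1)) x = (\<lambda>v. v)"
    "\<And>i. f ((ad ^^ i) x) = (if i = 2 ^ n - 1 then 1 else 0)"
    using dual_vector[of f, OF f(1,2) zero_less_power[OF pos2] f_id y] by blast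
  interpret dual_chain scale b e f "2 ^ n" x
  proof unfold_locales
    show "(0::nat) < 2 ^ n"
      by simp
  qed (rule f x | assumption)+
  show ?thesis
    by (intro exI[of _ complement] conjI ke_module_complement module_iso_sp module_iso_quotient)
qed

end

theorem proposition10p5:
  fixes scale :: "'k::alg_closed_field \<Rightarrow> 'v::ab_group_add \<Rightarrow> 'v"
    and b :: "'v \<Rightarrow> 'v \<Rightarrow> 'k"
    and e :: "'v \<Rightarrow> 'v"
    and ell t t' t'' \<alpha> :: nat
    and m k l d :: "nat \<Rightarrow> nat"
  assumes char2: "CHAR('k) = 2"
    and V: "symplectic_space scale b"
    and dim_V: "vector_space.dim scale (UNIV :: 'v set) = 2 * ell"
    and e_sp: "e \<in> sp scale b"
    and e_nilpotent: "nilpotent_map e"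
    and decomposition: "orthogonal_decomposition scale b e
           (map (\<lambda>i. BW (m i)) [1..<Suc t] @
            map (\<lambda>j. BWk (k j) (l j)) [1..<Suc t'] @
            map (\<lambda>r. BV (d r)) [1..<Suc t''])"
    and \<alpha>_divides: "\<forall>i\<in>{1..t}. 2 ^ \<alpha> dvd m i" "\<forall>j\<in>{1..t'}. 2 ^ \<alpha> dvd l j"
           "\<forall>r\<in>{1..t''}. 2 ^ \<alpha> dvd 2 * d r"
    and \<alpha>_largest: "\<And>\<beta>::nat. (\<forall>i\<in>{1..t}. 2 ^ \<beta> dvd m i) \<Longrightarrow> (\<forall>j\<in>{1..t'}. 2 ^ \<beta> dvd l j) \<Longrightarrow>
           (\<forall>r\<in>{1..t''}. 2 ^ \<beta> dvd 2 * d r) \<Longrightarrow> \<beta> \<le> \<alpha>"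
  shows "\<exists>V' :: ('k, 'v \<Rightarrow> 'v) op_module. ke_module e V' \<and>
           module_iso (sp_module scale b e) (direct_sum (W_module (2 ^ \<alpha>)) V') \<and>
           module_iso (quotient_module (sp_module scale b e) (lie_center (sp scale b)))
                      (direct_sum (W_module (2 ^ \<alpha> - 1)) V')"
proof -
  interpret symplectic_space scale b
    by (rule V)
  interpret char2_symplectic scale b e
    by unfold_locales (rule char2 e_sp)+
  let ?Bs = "map (\<lambda>i. BW (m i)) [1..<Suc t] @ map (\<lambda>j. BWk (k j) (l j)) [1..<Suc t'] @
    map (\<lambda>r. BV (d r)) [1..<Suc t'']"
  have dvd_iff: "(\<forall>B\<in>set ?Bs. c dvd block_size B) \<longleftrightarrow> (\<forall>i\<in>{1..t}. c dvd m i) \<and>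
      (\<forall>j\<in>{1..t'}. c dvd l j) \<and> (\<forall>r\<in>{1..t''}. c dvd 2 * d r)" for c
    unfolding set_append set_map set_upt ball_Un ball_simps(9) block_size.simps
      atLeastLessThanSuc_atLeastAtMost ..
  \<comment> \<open>Maximality of \<open>\<alpha>\<close> provides the block with odd quotient; in
    particular the list of blocks is not empty.\<close>
  have "\<exists>B\<in>set ?Bs. \<not> 2 ^ Suc \<alpha> dvd block_size B"
  proof (rule ccontr)
    assume "\<not> ?thesis"
    then have "\<forall>B\<in>set ?Bs. 2 ^ Suc \<alpha> dvd block_size B"
      by simp
    then have "Suc \<alpha> \<le> \<alpha>"
      unfolding dvd_iff by (intro \<alpha>_largest) (elim conjE, assumption)+
    then show False
      by simp
  qed
  then obtain B where B: "B \<in> set ?Bs" "\<not> 2 ^ Suc \<alpha> dvd block_size B"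
    by (rule bexE)
  have all: "\<forall>B\<in>set ?Bs. 2 ^ \<alpha> dvd block_size B"
    unfolding dvd_iff by (intro conjI \<alpha>_divides)
  show ?thesis
    by (rule sp_module_splitting[OF decomposition bspec[OF all] B])
qed

end
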